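(* Let $p$ be a prime, $S$ a finite $p$-group, and $\mathcal{A}$ a set of abelian subgroups of $S$ satisfying: (replacement in $S$) for every $B\trianglelefteq S$ of nilpotency class $\leq 2$, if there exist members of $\mathcal{A}$ that contain $[B,B]$ but do not contain $B$, then $B$ normalizes one of them (that is, $B$ normalizes some member of $\mathcal{A}$ that contains $[B,B]$ but not $B$); (full invariance in $S$) for every $P\trianglelefteq S$, the subgroup $I_{\mathcal{A}|P}$ is $\mathrm{Aut}(P)$-invariant. Then $I_{\mathcal{A}}$ has the Glauberman property for $S$.
   Context: All groups are finite. For a set $\mathcal{A}$ of abelian subgroups of a $p$-group $S$, $I_{\mathcal{A}}:=\bigcap_{A\in\mathcal{A}}A$, with the convention $I_{\mathcal{A}}=1$ if $\mathcal{A}=\emptyset$. For $P\leq S$, $\mathcal{A}|_P:=\{A\in\mathcal{A}: A\leq P\}$ and $I_{\mathcal{A}|P}:=I_{\mathcal{A}|_P}$. A subgroup of $S$ has the Glauberman property for $S$ if it is characteristic in every finite group $G$ satisfying: (a) $S$ is a Sylow $p$-subgroup of $G$; (b) $C_G(O_p(G))\leq O_p(G)$; (c) $G$ acts (by conjugation) $p$-stably on every normal $p$-subgroup of $G$. $O_p(G)$ is the largest normal $p$-subgroup of $G$. If $G$ acts on a $p$-group $P$, then $O_p(G\curvearrowright P)\trianglelefteq G$ denotes the preimage of $O_p(G/C_G(P))$ under the natural map $G\to G/C_G(P)$. An element $x\in G$ acts quadratically on $P$ if $[P,x,x]=1$, where $[P,x,x]=[[P,x],x]$ and commutators are $[w,x]=w^{-1}x^{-1}wx$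 (in $P\rtimes G$). The action of $G$ on $P$ is $p$-stable if every element of $G$ that acts quadratically on $P$ lies in $O_p(G\curvearrowright P)$. *)

theory Defs
  imports "HOL-Algebra.Algebra" "HOL-Computational_Algebra.Primes"
begin

section \<open>$p$-subgroups, cores and centralizers\<close>

definition p_subgroup :: "nat \<Rightarrow> ('a, 'm) monoid_scheme \<Rightarrow> 'a set \<Rightarrow> bool"
  where "p_subgroup p G H \<longleftrightarrow> subgroup H G \<and> (\<exists>n. card H = p ^ n)"

definition sylow_subgroup :: "nat \<Rightarrow> ('a, 'm) monoid_scheme \<Rightarrow> 'a set \<Rightarrow> bool"
  where "sylow_subgroup p G H \<longleftrightarrow> subgroup H G \<and> card H = p ^ multiplicity p (order G)"

text \<open>The largest (with respect to inclusion) normal \<open>p\<close>-subgroup, \<open>O\<^sub>p(G)\<close>.\<close>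

definition p_core :: "nat \<Rightarrow> ('a, 'm) monoid_scheme \<Rightarrow> 'a set"
  where "p_core p G = (GREATEST N. N \<lhd> G \<and> p_subgroup p G N)"

lemma (in group) inv_mult_cancel: "x \<in> carrier G \<Longrightarrow> y \<in> carrier G \<Longrightarrow> inv x \<otimes> (x \<otimes> y) = y"
  by (simp add: m_assoc[symmetric])

lemma (in group) p_core_greatest:
  assumes fin: "finite (carrier G)" and p: "Factorial_Ring.prime (p::nat)"
  shows "p_core p G \<lhd> G" "p_subgroup p G (p_core p G)"
    and "\<And>N. N \<lhd> G \<Longrightarrow> p_subgroup p G N \<Longrightarrow> N \<subseteq> p_core p G"
proof -
  let ?Q = "\<lambda>N. N \<lhd> G \<and> p_subgroup p G N"
  have fs: "finite {N. ?Q N}"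
    by (rule finite_subset[of _ "Pow (carrier G)"])
       (use fin in \<open>auto simp: p_subgroup_def dest: subgroup.subset\<close>)
  have ne: "{\<one>} \<in> {N. ?Q N}"
    using one_is_normal triv_subgroup by (auto simp: p_subgroup_def intro: exI[of _ 0])
  have "\<exists>N. N \<in> {N. ?Q N} \<and> (\<forall>M\<in>{N. ?Q N}. N \<subseteq> M \<longrightarrow> N = M)"
    using finite_has_maximal[OF fs] ne by blast
  then obtain N where N: "?Q N" and mx: "\<And>M. ?Q M \<Longrightarrow> N \<subseteq> M \<Longrightarrow> N = M" by blast
  have "M \<subseteq> N" if M: "?Q M" for M
  proof -
    interpret N: second_isomorphism_grp N G M
      using N M by (simp add: second_isomorphism_grp_def second_isomorphism_grp_axioms_def p_subgroup_def)
    let ?H = "N <#> M"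
    have sub: "subgroup ?H G" by (rule N.normal_set_mult_subgroup)
    have nrm: "?H \<lhd> G"
    proof (subst normal_inv_iff, intro conjI ballI sub)
      fix x h assume x: "x \<in> carrier G" and "h \<in> ?H"
      then obtain n m where nm: "n \<in> N" "m \<in> M" "h = n \<otimes> m" by (auto simp: set_mult_def)
      have c: "n \<in> carrier G" "m \<in> carrier G" using nm N.subset M subgroup.subset
        unfolding p_subgroup_def by blast+
      have "x \<otimes> h \<otimes> inv x = (x \<otimes> n \<otimes> inv x) \<otimes> (x \<otimes> m \<otimes> inv x)"
        using x c nm(3) by (simp add: m_assoc inv_mult_cancel)
      moreover have "x \<otimes> n \<otimes> inv x \<in> N" "x \<otimes> m \<otimes> inv x \<in> M"
        using normal.inv_op_closed2[of N G x n] normal.inv_op_closed2[of M G x m] x nm N M by simp_all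
      ultimately show "x \<otimes> h \<otimes> inv x \<in> ?H" by (auto simp: set_mult_def)
    qed
    have NH: "N \<subseteq> ?H" by (rule N.H_contained_in_set_mult)
    have MH: "M \<subseteq> ?H" by (rule N.S_contained_in_set_mult)
    obtain a b where ab: "card N = p ^ a" "card M = p ^ b" using N M by (auto simp: p_subgroup_def)
    interpret HG: group "G\<lparr>carrier := ?H\<rparr>" using sub subgroup_imp_group by blast
    interpret MG: group "G\<lparr>carrier := M\<rparr>" using N.subgrpS subgroup_imp_group by blast
    have 1: "card (rcosets\<^bsub>G\<lparr>carrier := ?H\<rparr>\<^esub> N) * card N = card ?H"
      using HG.lagrange[OF subgroup_incl[OF N.is_subgroup sub NH]] by (simp add: order_def)
    have 2: "card (rcosets\<^bsub>G\<lparr>carrier := M\<rparr>\<^esub> (N \<inter> M)) * card (N \<inter> M) = card M"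
      using MG.lagrange[OF subgroup_incl[OF subgroups_Inter_pair[OF N.is_subgroup N.subgrpS] N.subgrpS]]
      by (simp add: order_def)
    have 3: "card (rcosets\<^bsub>G\<lparr>carrier := ?H\<rparr>\<^esub> N) = card (rcosets\<^bsub>G\<lparr>carrier := M\<rparr>\<^esub> (N \<inter> M))"
      using N.normal_intersection_quotient_isom by (auto simp: iso_def FactGroup_def dest: bij_betw_same_card)
    have "card (rcosets\<^bsub>G\<lparr>carrier := ?H\<rparr>\<^esub> N) dvd card M" unfolding 3 2[symmetric] by simp
    then have "card ?H dvd p ^ (b + a)" unfolding 1[symmetric] using ab by (simp add: power_add)
    then have "\<exists>n. card ?H = p ^ n" using divides_primepow_nat[OF p] by auto
    then have "N = ?H" using mx[of ?H] nrm sub NH by (simp add: p_subgroup_def)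
    then show ?thesis using MH by simp
  qed
  then have "p_core p G = N" unfolding p_core_def using N by (intro Greatest_equality) auto
  with N \<open>\<And>M. ?Q M \<Longrightarrow> M \<subseteq> N\<close>
  show "p_core p G \<lhd> G" "p_subgroup p G (p_core p G)"
    "\<And>N. N \<lhd> G \<Longrightarrow> p_subgroup p G N \<Longrightarrow> N \<subseteq> p_core p G" by auto
qed

definition centralizer :: "('a, 'm) monoid_scheme \<Rightarrow> 'a set \<Rightarrow> 'a set"
  where "centralizer G H = {g \<in> carrier G. \<forall>h\<in>H. g \<otimes>\<^bsub>G\<^esub> h = h \<otimes>\<^bsub>G\<^esub> g}"

text \<open>\<^const>\<open>auto\<close> is the set of automorphisms of a group, from \<^theory>\<open>HOL-Algebra.Bij\<close>.\<close>

definition characteristic :: "('a, 'm) monoid_scheme \<Rightarrow> 'a set \<Rightarrow> bool"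
  where "characteristic G H \<longleftrightarrow> subgroup H G \<and> (\<forall>\<alpha>\<in>auto G. \<alpha> ` H = H)"


section \<open>Commutators and nilpotency class\<close>

text \<open>The commutators are written in the form used by \<^const>\<open>derived\<close>, so that
  \<open>comm_subgroup G H H\<close> is \<open>derived G H\<close>. For subgroups \<open>H\<close> and \<open>K\<close>, replacing \<open>h\<close> and \<open>k\<close> by
  their inverses shows that the commutators \<open>h\<inverse> k\<inverse> h k\<close> form the same set.\<close>

definition comm_subgroup :: "('a, 'm) monoid_scheme \<Rightarrow> 'a set \<Rightarrow> 'a set \<Rightarrow> 'a set"
  where "comm_subgroup G H K =
    generate G (\<Union>h\<in>H. \<Union>k\<in>K. {h \<otimes>\<^bsub>G\<^esub> k \<otimes>\<^bsub>G\<^esub> inv\<^bsub>G\<^esub> h \<otimes>\<^bsub>G\<^esub> inv\<^bsub>G\<^esub> k})"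

lemma comm_subgroup_self: "comm_subgroup G H H = derived G H"
  by (simp add: comm_subgroup_def derived_def)

text \<open>Indexed from \<open>0\<close>: \<open>lower_central G H n\<close> is usually written \<open>\<gamma>\<^sub>n\<^sub>+\<^sub>1(H)\<close>.\<close>

fun lower_central :: "('a, 'm) monoid_scheme \<Rightarrow> 'a set \<Rightarrow> nat \<Rightarrow> 'a set"
  where
    "lower_central G H 0 = H"
  | "lower_central G H (Suc n) = comm_subgroup G (lower_central G H n) H"

definition nilpotency_class_le :: "('a, 'm) monoid_scheme \<Rightarrow> 'a set \<Rightarrow> nat \<Rightarrow> bool"
  where "nilpotency_class_le G H c \<longleftrightarrow> lower_central G H c = {\<one>\<^bsub>G\<^esub>}"


section \<open>$p$-stable actions\<close>

text \<open>An action of \<open>G\<close> on \<open>P\<close> by automorphisms is a homomorphism \<open>\<phi>\<close> from \<open>G\<close> to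
  \<^term>\<open>AutoGroup P\<close>. It is a left action: \<open>x w x\<inverse> = \<phi> x w\<close> in the semidirect product.\<close>

definition action_centralizer ::
    "('g, 'm) monoid_scheme \<Rightarrow> ('a, 'n) monoid_scheme \<Rightarrow> ('g \<Rightarrow> 'a \<Rightarrow> 'a) \<Rightarrow> 'g set"
  where "action_centralizer G P \<phi> = {g \<in> carrier G. \<forall>w\<in>carrier P. \<phi> g w = w}"

text \<open>\<open>O\<^sub>p(G \<curvearrowright> P)\<close>, the preimage of \<open>O\<^sub>p(G/C\<^sub>G(P))\<close> in \<open>G\<close>.\<close>

definition p_core_action ::
    "nat \<Rightarrow> ('g, 'm) monoid_scheme \<Rightarrow> ('a, 'n) monoid_scheme \<Rightarrow> ('g \<Rightarrow> 'a \<Rightarrow> 'a) \<Rightarrow> 'g set"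
  where "p_core_action p G P \<phi> =
    {g \<in> carrier G. action_centralizer G P \<phi> #>\<^bsub>G\<^esub> g \<in> p_core p (G Mod action_centralizer G P \<phi>)}"

text \<open>\<open>[W, x]\<close>, generated by the commutators \<open>[w, x] = w\<inverse> (x\<inverse> w x)\<close> of the semidirect
  product, for \<open>w \<in> W\<close>.\<close>

definition action_comm ::
    "('g, 'm) monoid_scheme \<Rightarrow> ('a, 'n) monoid_scheme \<Rightarrow> ('g \<Rightarrow> 'a \<Rightarrow> 'a) \<Rightarrow> 'a set \<Rightarrow> 'g \<Rightarrow> 'a set"
  where "action_comm G P \<phi> W x = generate P ((\<lambda>w. inv\<^bsub>P\<^esub> w \<otimes>\<^bsub>P\<^esub> \<phi> (inv\<^bsub>G\<^esub> x) w) ` W)"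

definition acts_quadratically ::
    "('g, 'm) monoid_scheme \<Rightarrow> ('a, 'n) monoid_scheme \<Rightarrow> ('g \<Rightarrow> 'a \<Rightarrow> 'a) \<Rightarrow> 'g \<Rightarrow> bool"
  where "acts_quadratically G P \<phi> x \<longleftrightarrow>
    action_comm G P \<phi> (action_comm G P \<phi> (carrier P) x) x = {\<one>\<^bsub>P\<^esub>}"

definition p_stable_action ::
    "nat \<Rightarrow> ('g, 'm) monoid_scheme \<Rightarrow> ('a, 'n) monoid_scheme \<Rightarrow> ('g \<Rightarrow> 'a \<Rightarrow> 'a) \<Rightarrow> bool"
  where "p_stable_action p G P \<phi> \<longleftrightarrow>
    (\<forall>x\<in>carrier G. acts_quadratically G P \<phi> x \<longrightarrow> x \<in> p_core_action p G P \<phi>)"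

definition conj_action :: "('a, 'm) monoid_scheme \<Rightarrow> 'a set \<Rightarrow> 'a \<Rightarrow> 'a \<Rightarrow> 'a"
  where "conj_action G P = (\<lambda>g\<in>carrier G. \<lambda>w\<in>P. g \<otimes>\<^bsub>G\<^esub> w \<otimes>\<^bsub>G\<^esub> inv\<^bsub>G\<^esub> g)"

lemma (in group) conj_action_hom:
  assumes "N \<lhd> G"
  shows "conj_action G N \<in> hom G (AutoGroup (G\<lparr>carrier := N\<rparr>))"
proof -
  interpret N: normal N G by fact
  have sub: "N \<subseteq> carrier G" by (rule N.subset)
  have cl: "g \<otimes> w \<otimes> inv g \<in> N" if "g \<in> carrier G" "w \<in> N" for g w
    using that N.inv_op_closed2 by blast
  have A: "conj_action G N g \<in> auto (G\<lparr>carrier := N\<rparr>)" if g: "g \<in> carrier G" for g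
  proof -
    have "conj_action G N g \<in> hom (G\<lparr>carrier := N\<rparr>) (G\<lparr>carrier := N\<rparr>)"
    proof (rule homI)
      fix x assume "x \<in> carrier (G\<lparr>carrier := N\<rparr>)"
      then show "conj_action G N g x \<in> carrier (G\<lparr>carrier := N\<rparr>)"
        using g cl by (simp add: conj_action_def)
    next
      fix x y assume "x \<in> carrier (G\<lparr>carrier := N\<rparr>)" "y \<in> carrier (G\<lparr>carrier := N\<rparr>)"
      then have xy: "x \<in> N" "y \<in> N" "x \<in> carrier G" "y \<in> carrier G" using sub by auto
      have "g \<otimes> (x \<otimes> y) \<otimes> inv g = (g \<otimes> x \<otimes> inv g) \<otimes> (g \<otimes> y \<otimes> inv g)"
        using g xy by (simp add: m_assoc inv_mult_cancel)
      then show "conj_action G N g (x \<otimes>\<^bsub>G\<lparr>carrier := N\<rparr>\<^esub> y)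
        = conj_action G N g x \<otimes>\<^bsub>G\<lparr>carrier := N\<rparr>\<^esub> conj_action G N g y"
        using g xy by (simp add: conj_action_def)
    qed
    moreover have "bij_betw (conj_action G N g) N N"
    proof (rule bij_betw_byWitness[where f' = "conj_action G N (inv g)"])
      have [simp]: "inv g \<in> carrier G" using g by simp
      have 1: "conj_action G N a (conj_action G N b x) = x"
        if "a \<in> carrier G" "b = inv a" "x \<in> N" for a b x
      proof -
        have c: "b \<in> carrier G" "x \<in> carrier G" using that sub by auto
        have "a \<otimes> (b \<otimes> x \<otimes> inv b) \<otimes> inv a = (a \<otimes> b) \<otimes> x \<otimes> (inv b \<otimes> inv a)"
          using that(1) c by (simp add: m_assoc)
        also have "\<dots> = x" using that(1,2) c by simp
        finally show ?thesis using that cl[of b x] c by (simp add: conj_action_def)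
      qed
      show "\<forall>a\<in>N. conj_action G N (inv g) (conj_action G N g a) = a" using 1[of "inv g" g] g by auto
      show "\<forall>a'\<in>N. conj_action G N g (conj_action G N (inv g) a') = a'" using 1[of g "inv g"] g by auto
      show "conj_action G N g ` N \<subseteq> N" using g cl by (auto simp: conj_action_def)
      show "conj_action G N (inv g) ` N \<subseteq> N" using g cl[of "inv g"] by (auto simp: conj_action_def)
    qed
    ultimately show ?thesis using g by (auto simp: auto_def Bij_def conj_action_def)
  qed
  show ?thesis
  proof (rule homI)
    fix x assume "x \<in> carrier G"
    then show "conj_action G N x \<in> carrier (AutoGroup (G\<lparr>carrier := N\<rparr>))"
      using A by (simp add: AutoGroup_def)
  next
    fix x y assume xy: "x \<in> carrier G" "y \<in> carrier G"
    have "conj_action G N (x \<otimes> y) = compose N (conj_action G N x) (conj_action G N y)"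
      using xy cl subsetD[OF sub] by (auto simp: conj_action_def compose_def m_assoc inv_mult_group)
    moreover have "conj_action G N x \<in> Bij N" "conj_action G N y \<in> Bij N"
      using A[of x] A[of y] xy by (auto simp: auto_def)
    ultimately show "conj_action G N (x \<otimes> y) =
       conj_action G N x \<otimes>\<^bsub>AutoGroup (G\<lparr>carrier := N\<rparr>)\<^esub> conj_action G N y"
      by (simp add: AutoGroup_def BijGroup_def)
  qed
qed


section \<open>The Glauberman property\<close>

text \<open>The finite groups having \<open>S\<close> as a Sylow \<open>p\<close>-subgroup are represented by embeddings \<open>\<iota>\<close> of
  \<open>S\<close> onto a Sylow \<open>p\<close>-subgroup of a group \<open>G\<close>. A definition cannot quantify over the type of the
  elements of \<open>G\<close>, so that type is a parameter; a theorem in which it is a type variable covers all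
  finite groups.\<close>

definition glauberman_property ::
    "'b itself \<Rightarrow> nat \<Rightarrow> ('a, 'm) monoid_scheme \<Rightarrow> 'a set \<Rightarrow> bool"
  where "glauberman_property _ p S H \<longleftrightarrow>
    subgroup H S \<and>
    (\<forall>(G :: 'b monoid) \<iota>.
      group G \<and> finite (carrier G) \<and>
      \<iota> \<in> hom S G \<and> inj_on \<iota> (carrier S) \<and>
      sylow_subgroup p G (\<iota> ` carrier S) \<and>
      centralizer G (p_core p G) \<subseteq> p_core p G \<and>
      (\<forall>P. P \<lhd> G \<and> p_subgroup p G P \<longrightarrow>
        p_stable_action p G (G\<lparr>carrier := P\<rparr>) (conj_action G P))
      \<longrightarrow> characteristic G (\<iota> ` H))"


section \<open>Sets of abelian subgroups\<close>

definition is_abelian_subgroup :: "('a, 'm) monoid_scheme \<Rightarrow> 'a set \<Rightarrow> bool"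
  where "is_abelian_subgroup S A \<longleftrightarrow> subgroup A S \<and> comm_group (S\<lparr>carrier := A\<rparr>)"

definition family_inter :: "('a, 'm) monoid_scheme \<Rightarrow> 'a set set \<Rightarrow> 'a set"
  where "family_inter S \<A> = (if \<A> = {} then {\<one>\<^bsub>S\<^esub>} else \<Inter>\<A>)"

definition family_restrict :: "'a set set \<Rightarrow> 'a set \<Rightarrow> 'a set set"
  where "family_restrict \<A> P = {A \<in> \<A>. A \<subseteq> P}"

text \<open>Here \<^term>\<open>derived S B\<close> is \<open>[B, B]\<close>.\<close>

definition replacement_in :: "('a, 'm) monoid_scheme \<Rightarrow> 'a set set \<Rightarrow> bool"
  where "replacement_in S \<A> \<longleftrightarrow>
    (\<forall>B. B \<lhd> S \<and> nilpotency_class_le S B 2 \<and>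
      (\<exists>A\<in>\<A>. derived S B \<subseteq> A \<and> \<not> B \<subseteq> A)
      \<longrightarrow> (\<exists>A\<in>\<A>. derived S B \<subseteq> A \<and> \<not> B \<subseteq> A \<and> B \<subseteq> normalizer S A))"

definition fully_invariant_in :: "('a, 'm) monoid_scheme \<Rightarrow> 'a set set \<Rightarrow> bool"
  where "fully_invariant_in S \<A> \<longleftrightarrow>
    (\<forall>P. P \<lhd> S \<longrightarrow> (\<forall>\<alpha>\<in>auto (S\<lparr>carrier := P\<rparr>).
      \<alpha> ` family_inter S (family_restrict \<A> P) = family_inter S (family_restrict \<A> P)))"

end

theory Submission
  imports Defs
begin

text \<open>
  Write \<open>Z = I\<^sub>\<A>\<close>. If \<open>B\<close> is a normal \<open>p\<close>-subgroup of \<open>G\<close>, then an abelian subgroup normalized by \<open>B\<close>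
  acts quadratically on \<open>B\<close>, so by \<open>p\<close>-stability it lies in \<open>O\<^sub>p(G \<curvearrowright> B)\<close>; in particular \<open>Z \<le> O\<^sub>p(G)\<close>.
  It remains to see that \<open>Z \<inter> B \<lhd> G\<close> for every such \<open>B\<close>. In a minimal counterexample \<open>B\<close> is the
  normal closure of \<open>Z \<inter> B\<close>, hence \<open>[B, B] < B\<close>, and minimality gives that \<open>[B, B]\<close> lies in \<open>Z\<close> and is
  central in \<open>B\<close>. Since \<open>B\<close> is not contained in \<open>Z\<close>, replacement provides some \<open>A \<in> \<A>\<close> normalized by
  \<open>B\<close> but not containing it, so \<open>A \<le> L\<close> for \<open>L = S \<inter> O\<^sub>p(G \<curvearrowright> B)\<close>. By the Frattini argument
  \<open>G = C\<^sub>G(B) N\<^sub>G(L)\<close>, so full invariance makes \<open>I\<^bsub>\<A>|L\<^esub> \<inter> B\<close> normal in \<open>G\<close>. It contains \<open>Z \<inter> B\<close>,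
  hence \<open>B\<close>, and is contained in \<open>A\<close>: a contradiction. Finally, every automorphism of \<open>G\<close>
  preserves \<open>S\<close> up to conjugation, so it preserves the normal subgroup \<open>Z\<close>.
\<close>

section \<open>Fixed points and Sylow subgroups\<close>

lemma (in group) mult_inv_cancel: "x \<in> carrier G \<Longrightarrow> y \<in> carrier G \<Longrightarrow> x \<otimes> (inv x \<otimes> y) = y"
  by (simp add: m_assoc[symmetric])

text \<open>Without a fixed point every orbit would have length p^k with k > 0, so p would divide
  \<open>card E\<close>, the sum of the orbit lengths.\<close>

lemma (in group_action) ex_fixed_point:
  assumes fin: "finite E" and p: "Factorial_Ring.prime (p::nat)" and ndvd: "\<not> p dvd card E"
    and orb: "\<And>x. x \<in> E \<Longrightarrow> \<exists>k. card (orbit G \<phi> x) = p ^ k"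
  shows "\<exists>x\<in>E. \<forall>g\<in>carrier G. \<phi> g x = x"
proof (rule ccontr)
  assume no: "\<not> ?thesis"
  have dvd: "p dvd card Or" if Or: "Or \<in> orbits G E \<phi>" for Or
  proof -
    obtain x where x: "x \<in> E" "Or = orbit G \<phi> x" using Or by (auto simp: orbits_def)
    obtain k where k: "card Or = p ^ k" using orb x by blast
    have "k \<noteq> 0"
    proof
      assume "k = 0"
      then obtain y where "Or = {y}" using k by (metis card_1_singletonE power_0)
      then have "Or = {x}" using orbit_refl[OF x(1)] x(2) by auto
      then have "\<forall>g\<in>carrier G. \<phi> g x = x" using x(2) by (auto simp: orbit_def)
      then show False using no x(1) by blast
    qed
    then show ?thesis using k by simp
  qed
  interpret pt: partition E "orbits G E \<phi>" by (rule orbit_partition)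
  have "card E = (\<Sum>Or\<in>orbits G E \<phi>. card Or)"
    using pt.disjoint_sum[OF fin, of "\<lambda>_. 1::nat"] by simp
  then have "p dvd card E" using dvd by (simp add: dvd_sum)
  then show False using ndvd by blast
qed

section \<open>Conjugation into subgroups of index prime to p, by the action on cosets\<close>

lemma (in group) l_coset_lcosets:
  assumes "subgroup T G" "q \<in> carrier G" "Y \<in> lcosets T"
  shows "q <# Y \<in> lcosets T"
  using assms lcos_m_assoc[OF subgroup.subset[OF assms(1)]] by (auto simp: LCOSETS_def)

lemma (in group) lcosets_action:
  assumes T: "subgroup T G" and Q: "subgroup Q G"
  shows "group_action (G\<lparr>carrier := Q\<rparr>) (lcosets T) (\<lambda>q. \<lambda>Y\<in>lcosets T. q <# Y)"
proof -
  have Qc: "q \<in> carrier G" if "q \<in> Q" for q using that subgroup.subset[OF Q] by blast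
  have Yc: "Y \<subseteq> carrier G" if "Y \<in> lcosets T" for Y
    using that lcosets_subset_PowG[OF T] by blast
  have cl: "q <# Y \<in> lcosets T" if "q \<in> Q" "Y \<in> lcosets T" for q Y
    using l_coset_lcosets[OF T] Qc that by blast
  have bij: "(\<lambda>Y\<in>lcosets T. q <# Y) \<in> Bij (lcosets T)" if q: "q \<in> Q" for q
  proof -
    have iq: "inv q \<in> Q" using q Q by (simp add: subgroup.m_inv_closed)
    have "bij_betw (\<lambda>Y. q <# Y) (lcosets T) (lcosets T)"
      by (rule bij_betw_byWitness[where f' = "\<lambda>Y. inv q <# Y"])
         (use q iq cl Yc Qc in \<open>auto simp: lcos_m_assoc lcos_mult_one\<close>)
    then show ?thesis by (auto simp: Bij_def cong: bij_betw_cong)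
  qed
  have "(\<lambda>q. \<lambda>Y\<in>lcosets T. q <# Y) \<in> hom (G\<lparr>carrier := Q\<rparr>) (BijGroup (lcosets T))"
  proof (rule homI)
    fix x y assume "x \<in> carrier (G\<lparr>carrier := Q\<rparr>)" "y \<in> carrier (G\<lparr>carrier := Q\<rparr>)"
    then have xy: "x \<in> Q" "y \<in> Q" by auto
    have "(\<lambda>Y\<in>lcosets T. x \<otimes> y <# Y)
        = compose (lcosets T) (\<lambda>Y\<in>lcosets T. x <# Y) (\<lambda>Y\<in>lcosets T. y <# Y)"
      using xy cl Yc Qc by (intro ext) (auto simp: compose_def restrict_def lcos_m_assoc)
    then show "(\<lambda>Y\<in>lcosets T. (x \<otimes>\<^bsub>G\<lparr>carrier := Q\<rparr>\<^esub> y) <# Y) =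
      (\<lambda>Y\<in>lcosets T. x <# Y) \<otimes>\<^bsub>BijGroup (lcosets T)\<^esub> (\<lambda>Y\<in>lcosets T. y <# Y)"
      using bij xy by (simp add: BijGroup_def)
  qed (simp add: bij BijGroup_def)
  then show ?thesis
    using subgroup_imp_group[OF Q] group_BijGroup
    by (simp add: group_action_def group_hom_def group_hom_axioms_def)
qed

lemma (in group) subgroup_card_dvd:
  assumes H: "subgroup H G" and K: "subgroup K G" and "H \<subseteq> K"
  shows "card H dvd card K"
proof -
  interpret K: group "G\<lparr>carrier := K\<rparr>" using subgroup_imp_group[OF K] .
  have "subgroup H (G\<lparr>carrier := K\<rparr>)" using subgroup_incl H K \<open>H \<subseteq> K\<close> by blast
  from K.lagrange[OF this] have "card (rcosets\<^bsub>G\<lparr>carrier := K\<rparr>\<^esub> H) * card H = card K"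
    by (simp add: order_def)
  then show ?thesis by (metis dvd_triv_right)
qed

text \<open>\<open>Q\<close> permutes the left cosets of \<open>T\<close>, whose number is prime to
  p. \<open>D\<close> acts trivially, so the orbit lengths are powers of p and some coset is fixed.
  For trivial \<open>D\<close> and Sylow \<open>T\<close> this is Sylow's theorem; in general
  \<open>Q\<close> is a p-group only modulo \<open>D\<close>.\<close>

lemma (in group) p_subgroup_conj_into:
  assumes fin: "finite (carrier G)" and p: "Factorial_Ring.prime (p::nat)"
    and T: "subgroup T G" and Q: "subgroup Q G"
    and D: "D \<lhd> G" "D \<subseteq> T" "D \<subseteq> Q" and cQ: "card Q = p ^ n * card D"
    and ndvd: "\<not> p * card T dvd order G"
  shows "\<exists>g\<in>carrier G. \<forall>q\<in>Q. inv g \<otimes> q \<otimes> g \<in> T"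
proof -
  let ?E = "lcosets T" let ?\<phi> = "\<lambda>q. \<lambda>Y\<in>lcosets T. q <# Y" let ?Q = "G\<lparr>carrier := Q\<rparr>"
  have Dsub: "subgroup D G" using D(1) normal_imp_subgroup by blast
  have [simp]: "q \<in> carrier G" if "q \<in> Q" for q using that subgroup.subset[OF Q] by blast
  have Tc: "T \<subseteq> carrier G" using subgroup.subset[OF T] .
  interpret act: group_action ?Q ?E ?\<phi> by (rule lcosets_action[OF T Q])
  interpret D: normal D G by fact
  have finE: "finite ?E" using lcosets_subset_PowG[OF T] fin by (meson finite_Pow_iff finite_subset)
  have cE: "card ?E * card T = order G" using l_lagrange[OF fin T] .
  have "\<not> p dvd card ?E"
  proof
    assume "p dvd card ?E"
    then have "p * card T dvd card ?E * card T" by (rule mult_dvd_mono) simp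
    then show False using ndvd cE by simp
  qed
  moreover have "\<exists>k. card (orbit ?Q ?\<phi> Y) = p ^ k" if Y: "Y \<in> ?E" for Y
  proof -
    let ?St = "stabilizer ?Q ?\<phi> Y"
    obtain x where x: "x \<in> carrier G" "Y = x <# T" using Y by (auto simp: LCOSETS_def)
    \<comment> \<open>d x T = x (x^-1 d x) T, and the conjugate of d lies in \<open>D\<close>, hence
      in \<open>T\<close>.\<close>
    have "d <# Y = Y" if d: "d \<in> D" for d
    proof -
      have dc: "d \<in> carrier G" using d D.subset by blast
      have e: "d \<otimes> x = x \<otimes> (inv x \<otimes> d \<otimes> x)" using x dc by (simp add: m_assoc[symmetric])
      have "inv x \<otimes> d \<otimes> x \<in> T" using D.inv_op_closed1[OF x(1) d] D(2) by blast
      then have "(inv x \<otimes> d \<otimes> x) <# T = T"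
        using coset_join3[OF _ T] subgroup.mem_carrier[OF T] by blast
      then have "x <# ((inv x \<otimes> d \<otimes> x) <# T) = Y" using x by simp
      then have "(d \<otimes> x) <# T = Y" using x dc Tc e by (simp add: lcos_m_assoc)
      then show ?thesis using x dc Tc by (simp add: lcos_m_assoc)
    qed
    then have DSt: "D \<subseteq> ?St" using D(3) Y by (auto simp: stabilizer_def)
    have "subgroup ?St ?Q" using act.stabilizer_subgroup[OF Y] .
    then have "subgroup ?St G" using incl_subgroup[OF Q] by simp
    \<comment> \<open>The stabilizer contains \<open>D\<close>, so \<open>card D\<close> cancels
      from the orbit-stabilizer equation and the orbit length divides p^n.\<close>
    then obtain k where k: "card ?St = card D * k" using subgroup_card_dvd[OF Dsub _ DSt] by (auto elim: dvdE)
    have D0: "card D \<noteq> 0" using D.one_closed D.subset fin by (metis card_0_eq empty_iff finite_subset)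
    have "card (orbit ?Q ?\<phi> Y) * card ?St = card Q"
      using act.orbit_stabilizer_theorem[OF Y] by (simp add: order_def)
    then have "card D * (card (orbit ?Q ?\<phi> Y) * k) = card D * p ^ n"
      unfolding k cQ by (simp add: mult_ac)
    then have "card (orbit ?Q ?\<phi> Y) * k = p ^ n" using D0 by simp
    then have "card (orbit ?Q ?\<phi> Y) dvd p ^ n" by (metis dvd_triv_left)
    then show ?thesis using divides_primepow_nat[OF p] by auto
  qed
  ultimately obtain Y where Y: "Y \<in> ?E" "\<forall>q\<in>Q. ?\<phi> q Y = Y"
    using act.ex_fixed_point[OF finE p] by auto
  obtain x where x: "x \<in> carrier G" "Y = x <# T" using Y by (auto simp: LCOSETS_def)
  have "inv x \<otimes> q \<otimes> x \<in> T" if q: "q \<in> Q" for q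
  proof -
    have "q <# Y = Y" using Y q by auto
    moreover have "x \<in> Y" using x T lcos_self by blast
    ultimately have "q \<otimes> x \<in> Y" unfolding l_coset_def by blast
    then have "q \<otimes> x \<in> x <# T" using x(2) by simp
    then have "inv x \<otimes> (q \<otimes> x) \<in> T" using subgroup.lcos_module_imp[OF T group_axioms x(1)] by blast
    then show ?thesis using q x by (simp add: m_assoc)
  qed
  then show ?thesis using x by blast
qed

text \<open>A maximal proper normal subgroup \<open>M\<close> misses some member \<open>N\<close> of the family, so that
  \<open>G = M N\<close> and \<open>G/M\<close> is a quotient of the abelian group \<open>N\<close>.\<close>

lemma (in group) derived_ne_carrier:
  assumes fin: "finite (carrier G)" and ne: "carrier G \<noteq> {\<one>}"
    and nrm: "\<And>N. N \<in> \<N> \<Longrightarrow> N \<lhd> G"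
    and ab: "\<And>N x y. N \<in> \<N> \<Longrightarrow> x \<in> N \<Longrightarrow> y \<in> N \<Longrightarrow> x \<otimes> y = y \<otimes> x"
    and gen: "carrier G = generate G (\<Union>\<N>)"
  shows "derived G (carrier G) \<noteq> carrier G"
proof -
  let ?F = "{M. M \<lhd> G \<and> M \<noteq> carrier G}"
  have "finite ?F"
    by (rule finite_subset[of _ "Pow (carrier G)"])
       (use fin in \<open>auto dest: normal_imp_subgroup subgroup.subset\<close>)
  moreover have "{\<one>} \<in> ?F" using one_is_normal ne by auto
  ultimately obtain M where M: "M \<lhd> G" "M \<noteq> carrier G"
    and mx: "\<And>K. K \<lhd> G \<Longrightarrow> M \<subseteq> K \<Longrightarrow> K = carrier G \<or> K = M"
    using finite_has_maximal[of ?F] by auto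
  interpret M: normal M G by fact
  have "\<exists>N\<in>\<N>. \<not> N \<subseteq> M"
  proof (rule ccontr)
    assume "\<not> ?thesis"
    then have "generate G (\<Union>\<N>) \<subseteq> M" by (intro generate_subgroup_incl[OF _ M.is_subgroup]) auto
    then show False using M gen M.subset by blast
  qed
  then obtain N where N: "N \<in> \<N>" "\<not> N \<subseteq> M" by blast
  interpret N: normal N G using nrm N by blast
  interpret MN: second_isomorphism_grp M G N by unfold_locales
  have "M <#> N \<lhd> G"
  proof (rule normal_invI[OF MN.normal_set_mult_subgroup])
    fix x h assume x: "x \<in> carrier G" and "h \<in> M <#> N"
    then obtain m n where mn: "m \<in> M" "n \<in> N" "h = m \<otimes> n" by (auto simp: set_mult_def)
    have "x \<otimes> h \<otimes> inv x = (x \<otimes> m \<otimes> inv x) \<otimes> (x \<otimes> n \<otimes> inv x)"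
      using x mn by (simp add: m_assoc inv_mult_cancel)
    then show "x \<otimes> h \<otimes> inv x \<in> M <#> N"
      using M.inv_op_closed2[OF x mn(1)] N.inv_op_closed2[OF x mn(2)] by (auto simp: set_mult_def)
  qed
  then have MN: "M <#> N = carrier G"
    using mx[OF _ MN.H_contained_in_set_mult] MN.S_contained_in_set_mult N(2) by auto
  have cos: "\<exists>n\<in>N. M #> x = M #> n" if x: "x \<in> carrier G" for x
  proof -
    obtain m n where mn: "m \<in> M" "n \<in> N" "x = m \<otimes> n" using x MN[symmetric] by (auto simp: set_mult_def)
    then have "M #> x = M #> n"
      using coset_mult_assoc[OF M.subset, of m n] M.rcos_const[OF group_axioms, of m] by simp
    then show ?thesis using mn by blast
  qed
  have comm: "(M #> x) <#> (M #> y) = (M #> y) <#> (M #> x)"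
    if xy: "x \<in> carrier G" "y \<in> carrier G" for x y
  proof -
    obtain a b where "a \<in> N" "M #> x = M #> a" "b \<in> N" "M #> y = M #> b" using cos xy by meson
    then show ?thesis using ab[OF N(1)] by (simp add: M.rcos_sum)
  qed
  have "x \<otimes> y \<otimes> inv x \<otimes> inv y \<in> M" if xy: "x \<in> carrier G" "y \<in> carrier G" for x y
  proof -
    have "M #> (x \<otimes> y) = M #> (y \<otimes> x)" using comm xy by (simp add: M.rcos_sum)
    moreover have "x \<otimes> y \<in> M #> (x \<otimes> y)" using rcos_self[OF _ M.is_subgroup] xy by simp
    ultimately obtain m where m: "m \<in> M" "x \<otimes> y = m \<otimes> (y \<otimes> x)" by (auto simp: r_coset_def)
    then have "x \<otimes> y \<otimes> inv (y \<otimes> x) \<in> M" using xy by (simp add: m_assoc)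
    then show ?thesis using xy by (simp add: inv_mult_group m_assoc)
  qed
  then have "derived G (carrier G) \<subseteq> M"
    unfolding derived_def by (intro generate_subgroup_incl[OF _ M.is_subgroup]) auto
  then show ?thesis using M M.subset by blast
qed

section \<open>Actions and commutators\<close>

text \<open>By the correspondence theorem this subgroup is the union of the cosets in O_p(G/C), so
  its order is |O_p(G/C)| |C|. It need not be a p-group, as C may have any order.\<close>

lemma (in group) p_core_action_normal:
  fixes P (structure)
  assumes fin: "finite (carrier G)" and p: "Factorial_Ring.prime (p::nat)"
    and C: "action_centralizer G P \<phi> \<lhd> G"
  shows "p_core_action p G P \<phi> \<lhd> G" "action_centralizer G P \<phi> \<subseteq> p_core_action p G P \<phi>"
    and "\<exists>n. card (p_core_action p G P \<phi>) = p ^ n * card (action_centralizer G P \<phi>)"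
proof -
  let ?C = "action_centralizer G P \<phi>"
  let ?N = "p_core p (G Mod ?C)"
  interpret C: normal ?C G by fact
  interpret F: group "G Mod ?C" by (rule C.factorgroup_is_group)
  have "carrier (G Mod ?C) \<subseteq> Pow (carrier G)"
    using rcosets_subset_PowG[OF C.is_subgroup] by (simp add: FactGroup_def)
  then have finF: "finite (carrier (G Mod ?C))" using fin by (meson finite_Pow_iff finite_subset)
  note N = F.p_core_greatest(1,2)[OF finF p]
  have Nsub: "subgroup ?N (G Mod ?C)" using N(1) normal_imp_subgroup by blast
  have K: "p_core_action p G P \<phi> = \<Union>?N"
    unfolding p_core_action_def using C.factgroup_subgroup_union_char[OF Nsub] by simp
  show Kn: "p_core_action p G P \<phi> \<lhd> G" unfolding K by (rule C.factgroup_subgroup_union_normal[OF N(1)])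
  have "?C \<in> ?N" using subgroup.one_closed[OF Nsub] by simp
  then show CK: "?C \<subseteq> p_core_action p G P \<phi>" unfolding K by blast
  let ?K = "p_core_action p G P \<phi>"
  have Ksub: "subgroup ?K G" using Kn normal_imp_subgroup by blast
  interpret KG: group "G\<lparr>carrier := ?K\<rparr>" using subgroup_imp_group[OF Ksub] .
  have "card (rcosets\<^bsub>G\<lparr>carrier := ?K\<rparr>\<^esub> ?C) * card ?C = card ?K"
    using KG.lagrange[OF subgroup_incl[OF C.is_subgroup Ksub CK]] by (simp add: order_def)
  then have "card ?N * card ?C = card ?K"
    using C.factgroup_subgroup_union_factor[OF Nsub] K by simp
  then show "\<exists>n. card ?K = p ^ n * card ?C" using N(2) by (metis p_subgroup_def)
qed

text \<open>The centralizer is the kernel of \<phi>: elements of \<open>AutoGroup P\<close> are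
  extensional, so one that fixes every element of \<open>P\<close> is the identity of that
  group.\<close>

lemma (in group) action_centralizer_normal:
  assumes P: "group P" and \<phi>: "\<phi> \<in> hom G (AutoGroup P)"
  shows "action_centralizer G P \<phi> \<lhd> G"
proof -
  interpret h: group_hom G "AutoGroup P" \<phi>
    using group.AutoGroup[OF P] \<phi> by (simp add: group_hom_def group_hom_axioms_def)
  have "\<phi> g = (\<lambda>w\<in>carrier P. w) \<longleftrightarrow> (\<forall>w\<in>carrier P. \<phi> g w = w)" if g: "g \<in> carrier G" for g
  proof -
    have ext: "\<phi> g \<in> extensional (carrier P)"
      using hom_in_carrier[OF \<phi> g] by (simp add: AutoGroup_def auto_def Bij_def)
    show ?thesis
    proof
      assume "\<forall>w\<in>carrier P. \<phi> g w = w"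
      then show "\<phi> g = (\<lambda>w\<in>carrier P. w)"
        by (intro extensionalityI[OF ext restrict_extensional]) simp
    qed simp
  qed
  then have "action_centralizer G P \<phi> = kernel G (AutoGroup P) \<phi>"
    by (auto simp: action_centralizer_def kernel_def AutoGroup_def BijGroup_def)
  then show ?thesis using h.normal_kernel by simp
qed

lemma (in group) action_centralizer_conj_action:
  assumes "N \<lhd> G"
  shows "action_centralizer G (G\<lparr>carrier := N\<rparr>) (conj_action G N) = centralizer G N"
proof -
  interpret N: normal N G by fact
  have "g \<otimes> w \<otimes> inv g = w \<longleftrightarrow> g \<otimes> w = w \<otimes> g" if "g \<in> carrier G" "w \<in> N" for g w
    using that inv_solve_right[of w "g \<otimes> w" g] by auto
  then show ?thesis by (auto simp: action_centralizer_def centralizer_def conj_action_def)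
qed

text \<open>\<open>[N, a] \<le> A\<close> because \<open>N\<close> normalizes \<open>A\<close>, and \<open>A\<close> is abelian.\<close>

lemma (in group) abelian_acts_quadratically:
  assumes N: "N \<lhd> G" and A: "subgroup A G"
    and ab: "\<And>x y. x \<in> A \<Longrightarrow> y \<in> A \<Longrightarrow> x \<otimes> y = y \<otimes> x"
    and nrm: "\<And>x y. x \<in> N \<Longrightarrow> y \<in> A \<Longrightarrow> x \<otimes> y \<otimes> inv x \<in> A"
    and a: "a \<in> A"
  shows "acts_quadratically G (G\<lparr>carrier := N\<rparr>) (conj_action G N) a"
proof -
  interpret N: normal N G by fact
  interpret A: subgroup A G by fact
  let ?H = "G\<lparr>carrier := N\<rparr>"
  interpret H: group ?H by (rule subgroup_imp_group[OF N.is_subgroup])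
  define W where "W = action_comm G ?H (conj_action G N) N a"
  have conj: "inv\<^bsub>?H\<^esub> w \<otimes>\<^bsub>?H\<^esub> conj_action G N (inv a) w = inv w \<otimes> (inv a \<otimes> w \<otimes> a)"
    if "w \<in> N" for w
    using that a by (simp add: conj_action_def m_inv_consistent[OF N.is_subgroup])
  have sub: "subgroup (A \<inter> N) ?H"
    by (intro subgroup_incl subgroups_Inter_pair A N.is_subgroup) simp_all
  have "W \<subseteq> A \<inter> N"
    unfolding W_def action_comm_def
  proof (rule H.generate_subgroup_incl[OF _ sub], rule image_subsetI)
    fix w assume w: "w \<in> N"
    have "inv w \<otimes> inv a \<otimes> w \<in> A" using nrm[of "inv w" "inv a"] w a by simp
    then have "(inv w \<otimes> inv a \<otimes> w) \<otimes> a \<in> A" using a by simp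
    moreover have "inv w \<otimes> (inv a \<otimes> w \<otimes> a) \<in> N" using N.inv_op_closed1[of a w] w a by simp
    ultimately show "inv\<^bsub>?H\<^esub> w \<otimes>\<^bsub>?H\<^esub> conj_action G N (inv a) w \<in> A \<inter> N"
      using conj[OF w] w a by (simp add: m_assoc)
  qed
  then have "inv\<^bsub>?H\<^esub> w \<otimes>\<^bsub>?H\<^esub> conj_action G N (inv a) w = \<one>\<^bsub>?H\<^esub>" if "w \<in> W" for w
  proof -
    have w: "w \<in> A" "w \<in> N" using that \<open>W \<subseteq> A \<inter> N\<close> by auto
    have "inv a \<otimes> w \<otimes> a = w" using ab[OF w(1) a] w a by (simp add: m_assoc inv_mult_cancel)
    then show ?thesis using conj[OF w(2)] w by simp
  qed
  then have "action_comm G ?H (conj_action G N) W a \<subseteq> {\<one>\<^bsub>?H\<^esub>}"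
    unfolding action_comm_def by (intro H.generate_subgroup_incl H.triv_subgroup) blast
  moreover have "\<one>\<^bsub>?H\<^esub> \<in> action_comm G ?H (conj_action G N) W a"
    unfolding action_comm_def by (rule generate.one)
  ultimately show ?thesis unfolding acts_quadratically_def W_def by simp blast
qed

section \<open>Conjugation, normalizers and commutators modulo a normal subgroup\<close>

lemma (in group) mem_normalizer:
  assumes "H \<subseteq> carrier G"
  shows "g \<in> normalizer G H \<longleftrightarrow> g \<in> carrier G \<and> g <# H #> inv g = H"
  using assms by (auto simp: normalizer_def stabilizer_def)

lemma (in group) conj_mult:
  "g \<in> carrier G \<Longrightarrow> x \<in> carrier G \<Longrightarrow> y \<in> carrier G
    \<Longrightarrow> g \<otimes> (x \<otimes> y) \<otimes> inv g = (g \<otimes> x \<otimes> inv g) \<otimes> (g \<otimes> y \<otimes> inv g)"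
  by (simp add: m_assoc inv_mult_cancel)

lemma (in group) inj_on_conj:
  assumes "g \<in> carrier G" "H \<subseteq> carrier G"
  shows "inj_on (\<lambda>x. g \<otimes> x \<otimes> inv g) H"
proof (rule inj_onI)
  fix x y assume "x \<in> H" "y \<in> H" "g \<otimes> x \<otimes> inv g = g \<otimes> y \<otimes> inv g"
  moreover from this have "x \<in> carrier G" "y \<in> carrier G" using assms by auto
  ultimately show "x = y" using assms by simp
qed

lemma (in group) conj_subgroup:
  assumes g: "g \<in> carrier G" and H: "subgroup H G"
  shows "subgroup ((\<lambda>x. g \<otimes> x \<otimes> inv g) ` H) G"
proof -
  have "group_hom G G (\<lambda>x. g \<otimes> x \<otimes> inv g)"
    using g conj_mult by (unfold_locales) (auto intro!: homI)
  from group_hom.subgroup_img_is_subgroup[OF this H] show ?thesis .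
qed

text \<open>These are the elements of \<open>H\<close> that are central in \<open>H\<close> modulo
  \<open>N\<close>. Closure follows from [a^-1, x] = a^-1 [a, x]^-1 a and [a b, x] = a [b, x] a^-1
  [a, x], where [a, x] = a x a^-1 x^-1.\<close>

lemma (in group) commutators_in_normal_subgroup:
  assumes H: "subgroup H G" and N: "N \<lhd> G"
  shows "subgroup {h \<in> H. \<forall>x\<in>H. h \<otimes> x \<otimes> inv h \<otimes> inv x \<in> N} G" (is "subgroup ?K G")
proof -
  interpret H: subgroup H G by fact
  interpret N: normal N G by fact
  show ?thesis
  proof (rule subgroupI)
    fix a assume "a \<in> ?K"
    then have a: "a \<in> H" "\<And>x. x \<in> H \<Longrightarrow> a \<otimes> x \<otimes> inv a \<otimes> inv x \<in> N" by auto
    have "inv a \<otimes> x \<otimes> inv (inv a) \<otimes> inv x \<in> N" if x: "x \<in> H" for x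
    proof -
      have "inv a \<otimes> inv (a \<otimes> x \<otimes> inv a \<otimes> inv x) \<otimes> a \<in> N"
        using N.inv_op_closed1 a x by simp
      then show ?thesis using a(1) x by (simp add: inv_mult_group m_assoc)
    qed
    then show "inv a \<in> ?K" using a(1) by simp
  next
    fix a b assume "a \<in> ?K" "b \<in> ?K"
    then have ab: "a \<in> H" "\<And>x. x \<in> H \<Longrightarrow> a \<otimes> x \<otimes> inv a \<otimes> inv x \<in> N"
      "b \<in> H" "\<And>x. x \<in> H \<Longrightarrow> b \<otimes> x \<otimes> inv b \<otimes> inv x \<in> N" by auto
    have "(a \<otimes> b) \<otimes> x \<otimes> inv (a \<otimes> b) \<otimes> inv x \<in> N" if x: "x \<in> H" for x
    proof -
      have "(a \<otimes> (b \<otimes> x \<otimes> inv b \<otimes> inv x) \<otimes> inv a) \<otimes> (a \<otimes> x \<otimes> inv a \<otimes> inv x) \<in> N"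
        using N.inv_op_closed2 N.m_closed ab x by simp
      then show ?thesis using ab(1,3) x by (simp add: inv_mult_group m_assoc inv_mult_cancel)
    qed
    then show "a \<otimes> b \<in> ?K" using ab by simp
  next
    have "\<one> \<in> ?K" using H.one_closed H.mem_carrier by simp
    then show "?K \<noteq> {}" by blast
  qed (use H.mem_carrier in auto)
qed

section \<open>Normality of the intersection\<close>

text \<open>\<open>S\<close> is a subset of \<open>G\<close> here, so that no embedding appears in
  the arguments; a general embedding is reduced to this by passing to images. For a nonempty family
  I is the plain intersection.\<close>

locale glauberman_family = group G for G :: "('a, 'm) monoid_scheme" (structure) +
  fixes p :: nat and S :: "'a set" and \<A> :: "'a set set"
  assumes fin: "finite (carrier G)" and p: "Factorial_Ring.prime p"
    and sylow: "sylow_subgroup p G S"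
    and core: "centralizer G (p_core p G) \<subseteq> p_core p G"
    and stable: "\<And>P. P \<lhd> G \<Longrightarrow> p_subgroup p G P \<Longrightarrow>
      p_stable_action p G (G\<lparr>carrier := P\<rparr>) (conj_action G P)"
    and nonempty: "\<A> \<noteq> {}"
    and abelian: "\<And>A. A \<in> \<A> \<Longrightarrow> is_abelian_subgroup (G\<lparr>carrier := S\<rparr>) A"
    and replacement: "replacement_in (G\<lparr>carrier := S\<rparr>) \<A>"
    and invariant: "fully_invariant_in (G\<lparr>carrier := S\<rparr>) \<A>"
begin

abbreviation "I P \<equiv> family_inter (G\<lparr>carrier := S\<rparr>) (family_restrict \<A> P)"
abbreviation "Z \<equiv> \<Inter>\<A>"

section \<open>The Sylow subgroup, the members of the family and their intersections\<close>

lemma S_subgroup: "subgroup S G"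
  using sylow by (simp add: sylow_subgroup_def)

lemma S_carrier: "x \<in> S \<Longrightarrow> x \<in> carrier G"
  using subgroup.mem_carrier[OF S_subgroup] .

sublocale S: group "G\<lparr>carrier := S\<rparr>"
  by (rule subgroup_imp_group[OF S_subgroup])

text \<open>This is the form in which \<open>p_subgroup_conj_into\<close> takes an index prime to p;
  one more factor p would exceed the p-part of \<open>order G\<close>.\<close>

lemma S_not_dvd: "\<not> p * card S dvd order G"
proof
  assume "p * card S dvd order G"
  then have "p ^ Suc (multiplicity p (order G)) dvd order G"
    using sylow by (simp add: sylow_subgroup_def)
  moreover have "order G \<noteq> 0" using order_gt_0_iff_finite fin by simp
  ultimately have "Suc (multiplicity p (order G)) \<le> multiplicity p (order G)"
    using p by (intro multiplicity_geI) auto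
  then show False by simp
qed

lemma p_subgroup_subset:
  assumes H: "subgroup H G" and K: "p_subgroup p G K" "H \<subseteq> K"
  shows "p_subgroup p G H"
proof -
  obtain n where n: "card K = p ^ n" "subgroup K G" using K(1) by (auto simp: p_subgroup_def)
  then have "card H dvd p ^ n" using subgroup_card_dvd[OF H n(2) K(2)] by simp
  then show ?thesis using H divides_primepow_nat[OF p] by (auto simp: p_subgroup_def)
qed

lemma S_p_subgroup: "p_subgroup p G S"
  using sylow by (auto simp: p_subgroup_def sylow_subgroup_def)

text \<open>The case of trivial \<open>D\<close> in \<open>p_subgroup_conj_into\<close>, hence
  Sylow's theorem.\<close>

lemma conj_into_S:
  assumes "p_subgroup p G Q"
  shows "\<exists>g\<in>carrier G. \<forall>q\<in>Q. inv g \<otimes> q \<otimes> g \<in> S"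
proof -
  obtain n where n: "card Q = p ^ n" "subgroup Q G" using assms by (auto simp: p_subgroup_def)
  show ?thesis
    by (rule p_subgroup_conj_into[OF fin p S_subgroup n(2) one_is_normal _ _ _ S_not_dvd, where n = n])
       (use n S_subgroup in \<open>auto simp: subgroup.one_closed\<close>)
qed

text \<open>Some conjugate of \<open>N\<close> lies in \<open>S\<close>, and \<open>N\<close> equals
  its conjugates.\<close>

lemma normal_p_subgroup_le_S:
  assumes N: "N \<lhd> G" "p_subgroup p G N"
  shows "N \<subseteq> S"
proof
  fix x assume x: "x \<in> N"
  interpret N: normal N G by fact
  obtain g where g: "g \<in> carrier G" "\<forall>q\<in>N. inv g \<otimes> q \<otimes> g \<in> S" using conj_into_S N(2) by blast
  have "g \<otimes> x \<otimes> inv g \<in> N" using N.inv_op_closed2 g x by blast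
  then have "inv g \<otimes> (g \<otimes> x \<otimes> inv g) \<otimes> g \<in> S" using g by blast
  then show "x \<in> S" using g x by (simp add: m_assoc inv_mult_cancel)
qed

lemma member:
  assumes "A \<in> \<A>"
  shows "subgroup A G" "A \<subseteq> S" "\<And>x y. x \<in> A \<Longrightarrow> y \<in> A \<Longrightarrow> x \<otimes> y = y \<otimes> x"
proof -
  have A: "subgroup A (G\<lparr>carrier := S\<rparr>)" "comm_group (G\<lparr>carrier := A\<rparr>)"
    using abelian[OF assms] by (auto simp: is_abelian_subgroup_def)
  show "subgroup A G" using incl_subgroup[OF S_subgroup A(1)] .
  show "A \<subseteq> S" using subgroup.subset[OF A(1)] by simp
  show "x \<otimes> y = y \<otimes> x" if "x \<in> A" "y \<in> A" for x y
    using that comm_monoid.m_comm[OF comm_group.axioms(1)[OF A(2)], of x y] by simp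
qed

text \<open>No member is lost by restricting to \<open>S\<close>, so full invariance at P = S
  applies to \<open>Z\<close>.\<close>

lemma Z_eq: "Z = I S"
proof -
  have "family_restrict \<A> S = \<A>" using member(2) by (auto simp: family_restrict_def)
  then show ?thesis using nonempty by (simp add: family_inter_def)
qed

lemma I_subgroup: "subgroup (I P) G"
proof (cases "family_restrict \<A> P = {}")
  case True
  then show ?thesis by (simp add: family_inter_def triv_subgroup)
next
  case False
  then show ?thesis using member(1) by (auto simp: family_inter_def family_restrict_def intro!: subgroups_Inter)
qed

lemma I_subset:
  assumes "subgroup P G"
  shows "I P \<subseteq> P"
proof (cases "family_restrict \<A> P = {}")
  case True
  then show ?thesis using subgroup.one_closed[OF assms] by (simp add: family_inter_def)
next
  case False
  then obtain A where "A \<in> family_restrict \<A> P" by blast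
  then have "\<Inter>(family_restrict \<A> P) \<subseteq> P" by (auto simp: family_restrict_def)
  then show ?thesis using False by (simp add: family_inter_def)
qed

text \<open>Members of \<open>auto\<close> are extensional, so \<beta> is first restricted to
  \<open>P\<close>. This does not change the image of \<open>I P\<close>, which lies in
  \<open>P\<close>.\<close>

lemma I_image:
  assumes P: "subgroup P G" "P \<lhd> G\<lparr>carrier := S\<rparr>" and bij: "bij_betw \<beta> P P"
    and hom: "\<And>x y. x \<in> P \<Longrightarrow> y \<in> P \<Longrightarrow> \<beta> (x \<otimes> y) = \<beta> x \<otimes> \<beta> y"
  shows "\<beta> ` I P = I P"
proof -
  have "restrict \<beta> P \<in> auto (G\<lparr>carrier := P\<rparr>)"
    using bij hom bij_betw_apply[OF bij] subgroup.m_closed[OF P(1)]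
    by (auto simp: auto_def Bij_def cong: bij_betw_cong intro!: homI)
  moreover have "\<forall>\<alpha>\<in>auto (G\<lparr>carrier := P\<rparr>). \<alpha> ` I P = I P"
    using invariant P(2) by (simp add: fully_invariant_in_def)
  ultimately have "restrict \<beta> P ` I P = I P" by blast
  moreover have "restrict \<beta> P ` I P = \<beta> ` I P" using I_subset[OF P(1)] by (intro image_cong) auto
  ultimately show ?thesis by simp
qed

text \<open>g need not lie in \<open>S\<close>: conjugation by g is injective on the finite set
  \<open>P\<close>, hence an automorphism of \<open>P\<close>, and full invariance concerns all of
  these.\<close>

lemma I_conj:
  assumes P: "subgroup P G" "P \<lhd> G\<lparr>carrier := S\<rparr>" and g: "g \<in> carrier G"
    and gP: "\<And>x. x \<in> P \<Longrightarrow> g \<otimes> x \<otimes> inv g \<in> P" and x: "x \<in> I P"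
  shows "g \<otimes> x \<otimes> inv g \<in> I P"
proof -
  have Pc: "P \<subseteq> carrier G" using subgroup.subset[OF P(1)] .
  have "finite P" using Pc fin finite_subset by blast
  then have "bij_betw (\<lambda>x. g \<otimes> x \<otimes> inv g) P P"
    using inj_on_conj[OF g Pc] gP endo_inj_surj[of P "\<lambda>x. g \<otimes> x \<otimes> inv g"]
    unfolding bij_betw_def by blast
  then have "(\<lambda>x. g \<otimes> x \<otimes> inv g) ` I P = I P"
    using g Pc conj_mult by (intro I_image[OF P]) (auto simp: subset_iff)
  then show ?thesis using x by blast
qed

lemma Z_subgroup: "subgroup Z G"
  using I_subgroup Z_eq by simp

lemma Z_carrier: "x \<in> Z \<Longrightarrow> x \<in> carrier G"
  using subgroup.mem_carrier[OF Z_subgroup] .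

lemma Z_comm: "x \<in> Z \<Longrightarrow> y \<in> Z \<Longrightarrow> x \<otimes> y = y \<otimes> x"
proof -
  obtain A where "A \<in> \<A>" using nonempty by blast
  then show "x \<in> Z \<Longrightarrow> y \<in> Z \<Longrightarrow> x \<otimes> y = y \<otimes> x" using member(3) by blast
qed

lemma S_normal_S: "S \<lhd> G\<lparr>carrier := S\<rparr>"
  using S.normal_self by simp

lemma Z_conj_S:
  assumes s: "s \<in> S" and x: "x \<in> Z"
  shows "s \<otimes> x \<otimes> inv s \<in> Z"
proof -
  have "s \<otimes> y \<otimes> inv s \<in> S" if "y \<in> S" for y
    using s that subgroup.m_closed[OF S_subgroup] subgroup.m_inv_closed[OF S_subgroup] by simp
  from I_conj[OF S_subgroup S_normal_S S_carrier[OF s] this] show ?thesis using x Z_eq by simp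
qed

section \<open>The action on a normal subgroup and the Frattini argument\<close>

abbreviation "C B \<equiv> action_centralizer G (G\<lparr>carrier := B\<rparr>) (conj_action G B)"
text \<open>For normal \<open>B\<close>, \<open>C B\<close> is the centralizer of \<open>B\<close>
  in \<open>G\<close>, and \<open>K B\<close> is O_p(G \<curvearrowright> B).\<close>

abbreviation "K B \<equiv> p_core_action p G (G\<lparr>carrier := B\<rparr>) (conj_action G B)"

lemma C_normal: "B \<lhd> G \<Longrightarrow> C B \<lhd> G"
  using action_centralizer_normal[OF subgroup_imp_group[OF normal_imp_subgroup] conj_action_hom] .

lemma K_props:
  assumes "B \<lhd> G"
  shows "K B \<lhd> G" "C B \<subseteq> K B" "\<exists>n. card (K B) = p ^ n * card (C B)"
  using p_core_action_normal[OF fin p C_normal[OF assms]] .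

lemma quadratic_subset_K:
  assumes B: "B \<lhd> G" "p_subgroup p G B" and A: "subgroup A G"
    and "\<And>x y. x \<in> A \<Longrightarrow> y \<in> A \<Longrightarrow> x \<otimes> y = y \<otimes> x"
    and "\<And>x y. x \<in> B \<Longrightarrow> y \<in> A \<Longrightarrow> x \<otimes> y \<otimes> inv x \<in> A"
  shows "A \<subseteq> K B"
proof
  fix a assume a: "a \<in> A"
  then have "acts_quadratically G (G\<lparr>carrier := B\<rparr>) (conj_action G B) a"
    using abelian_acts_quadratically[OF B(1) A] assms(4,5) by blast
  then show "a \<in> K B"
    using stable[OF B] subgroup.mem_carrier[OF A a] by (auto simp: p_stable_action_def)
qed

text \<open>Take B = O_p(G). Its centralizer lies in \<open>B\<close> and so is a p-group, which
  makes \<open>K B\<close> a normal p-subgroup, contained in O_p(G). By p-stability \<open>Z\<close>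
  lies in \<open>K B\<close>.\<close>

lemma Z_subset_p_core: "Z \<subseteq> p_core p G"
proof -
  let ?P = "p_core p G"
  note P = p_core_greatest[OF fin p]
  have PS: "?P \<subseteq> S" by (rule normal_p_subgroup_le_S[OF P(1,2)])
  have "Z \<subseteq> K ?P"
    by (rule quadratic_subset_K[OF P(1,2) Z_subgroup Z_comm]) (use PS Z_conj_S in blast)+
  moreover have "p_subgroup p G (K ?P)"
  proof -
    have C: "C ?P \<subseteq> ?P" using core action_centralizer_conj_action[OF P(1)] by simp
    have "p_subgroup p G (C ?P)"
      by (rule p_subgroup_subset[OF _ P(2) C]) (use C_normal[OF P(1)] normal_imp_subgroup in blast)
    then obtain m where m: "card (C ?P) = p ^ m" by (auto simp: p_subgroup_def)
    obtain n where "card (K ?P) = p ^ n * card (C ?P)" using K_props(3)[OF P(1)] by blast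
    then have "card (K ?P) = p ^ (n + m)" using m by (simp add: power_add)
    then show ?thesis using K_props(1)[OF P(1)] normal_imp_subgroup by (auto simp: p_subgroup_def)
  qed
  ultimately show ?thesis using P(3)[OF K_props(1)[OF P(1)]] by blast
qed

text \<open>Modulo \<open>C B\<close> the group \<open>K B\<close> is a p-group, and
  \<open>C B <#> S\<close> has index prime to p since it contains \<open>S\<close>. So
  \<open>K B\<close> is conjugate into \<open>C B <#> S\<close>, and being normal it lies there
  itself.\<close>

lemma K_subset:
  assumes B: "B \<lhd> G"
  shows "K B \<subseteq> C B <#> S"
proof
  note CN = C_normal[OF B]
  interpret CB: normal "C B" G by (rule CN)
  interpret KB: normal "K B" G by (rule K_props(1)[OF B])
  interpret CS: second_isomorphism_grp "C B" G S
    by (simp add: second_isomorphism_grp_def second_isomorphism_grp_axioms_def CB.normal_axioms S_subgroup)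
  obtain n where n: "card (K B) = p ^ n * card (C B)" using K_props(3)[OF B] by blast
  have "card S dvd card (C B <#> S)"
    by (rule subgroup_card_dvd[OF S_subgroup CS.normal_set_mult_subgroup CS.S_contained_in_set_mult])
  then have "\<not> p * card (C B <#> S) dvd order G"
    using S_not_dvd by (meson dvd_refl dvd_trans mult_dvd_mono)
  then obtain g where g: "g \<in> carrier G" "\<forall>q\<in>K B. inv g \<otimes> q \<otimes> g \<in> C B <#> S"
    using p_subgroup_conj_into[OF fin p CS.normal_set_mult_subgroup KB.is_subgroup CN
        CS.H_contained_in_set_mult K_props(2)[OF B] n] by blast
  fix x assume x: "x \<in> K B"
  then have "g \<otimes> x \<otimes> inv g \<in> K B" using KB.inv_op_closed2 g(1) by blast
  then have "inv g \<otimes> (g \<otimes> x \<otimes> inv g) \<otimes> g \<in> C B <#> S" using g by blast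
  then show "x \<in> C B <#> S" using g x by (simp add: m_assoc inv_mult_cancel)
qed

text \<open>The Frattini argument, carried out in \<open>C\<^sub>G(B) S\<close> rather than in \<open>O\<^sub>p(G \<curvearrowright> B)\<close>, because \<open>S\<close> is
  visibly a Sylow subgroup of the former.\<close>

lemma frattini:
  assumes B: "B \<lhd> G" and g: "g \<in> carrier G"
  shows "\<exists>c\<in>C B. \<forall>l\<in>K B \<inter> S. (inv c \<otimes> g) \<otimes> l \<otimes> inv (inv c \<otimes> g) \<in> K B \<inter> S"
proof -
  interpret CB: normal "C B" G by (rule C_normal[OF B])
  interpret KB: normal "K B" G by (rule K_props(1)[OF B])
  interpret CS: second_isomorphism_grp "C B" G S
    by (simp add: second_isomorphism_grp_def second_isomorphism_grp_axioms_def CB.normal_axioms S_subgroup)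
  let ?M = "C B <#> S" let ?L = "K B \<inter> S" let ?Q = "(\<lambda>x. g \<otimes> x \<otimes> inv g) ` ?L"
  let ?H = "G\<lparr>carrier := ?M\<rparr>"
  note Msub = CS.normal_set_mult_subgroup
  interpret M: group ?H by (rule subgroup_imp_group[OF Msub])
  have SM: "subgroup S ?H" using subgroup_incl[OF S_subgroup Msub CS.S_contained_in_set_mult] .
  have Lsub: "subgroup ?L G" by (rule subgroups_Inter_pair[OF KB.is_subgroup S_subgroup])
  have QK: "?Q \<subseteq> K B" using KB.inv_op_closed2 g by auto
  have QM: "subgroup ?Q ?H"
    using subgroup_incl[OF conj_subgroup[OF g Lsub] Msub] QK K_subset[OF B] by blast
  obtain n where n: "card ?L = p ^ n"
    using p_subgroup_subset[OF Lsub S_p_subgroup] by (auto simp: p_subgroup_def)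
  \<comment> \<open>Sylow's theorem will be applied inside \<open>?M\<close>, with the trivial
    subgroup as \<open>D\<close>; its order 1 is the extra factor.\<close>
  have cQ: "card ?Q = p ^ n * card {\<one>\<^bsub>?H\<^esub>}"
    using card_image[OF inj_on_conj[OF g subgroup.subset[OF Lsub]]] n by simp
  \<comment> \<open>The index of \<open>S\<close> in \<open>?M\<close> divides its index in
    \<open>G\<close>, so it is prime to p as well.\<close>
  have "card ?M dvd order G"
    using subgroup_card_dvd[OF Msub subgroup_self] subgroup.subset[OF Msub] by (simp add: order_def)
  then have "\<not> p * card S dvd card ?M" using S_not_dvd dvd_trans by blast
  then have "\<not> p * card S dvd order ?H" by (simp add: order_def)
  moreover have "finite (carrier ?H)" using fin subgroup.subset[OF Msub] finite_subset by auto
  ultimately obtain m where m: "m \<in> ?M" "\<forall>q\<in>?Q. inv\<^bsub>?H\<^esub> m \<otimes> q \<otimes> m \<in> S"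
    using M.p_subgroup_conj_into[OF _ p SM QM M.one_is_normal _ _ cQ]
      subgroup.one_closed[OF SM] subgroup.one_closed[OF QM] by auto
  obtain c s where cs: "c \<in> C B" "s \<in> S" "m = c \<otimes> s" using m(1) by (auto simp: set_mult_def)
  have scar: "s \<in> carrier G" and ccar: "c \<in> carrier G" using cs S_carrier by auto
  have "(inv c \<otimes> g) \<otimes> l \<otimes> inv (inv c \<otimes> g) \<in> ?L" if l: "l \<in> ?L" for l
  proof -
    define q where "q = g \<otimes> l \<otimes> inv g"
    have lc: "l \<in> carrier G" using l by auto
    have q: "q \<in> ?Q" "q \<in> K B" "q \<in> carrier G" using l QK q_def by auto
    have "inv m \<otimes> q \<otimes> m \<in> S" using m q(1) m_inv_consistent[OF Msub m(1)] by auto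
    then have "s \<otimes> (inv m \<otimes> q \<otimes> m) \<otimes> inv s \<in> S"
      using cs(2) subgroup.m_closed[OF S_subgroup] subgroup.m_inv_closed[OF S_subgroup] by simp
    moreover have "s \<otimes> (inv m \<otimes> q \<otimes> m) \<otimes> inv s = inv c \<otimes> q \<otimes> c"
      using scar ccar q(3) cs(3) by (simp add: inv_mult_group m_assoc mult_inv_cancel)
    moreover have "inv c \<otimes> q \<otimes> c \<in> K B" using KB.inv_op_closed1[OF ccar q(2)] .
    moreover have "(inv c \<otimes> g) \<otimes> l \<otimes> inv (inv c \<otimes> g) = inv c \<otimes> q \<otimes> c"
      using lc g ccar q_def by (simp add: inv_mult_group m_assoc)
    ultimately show ?thesis by simp
  qed
  then show ?thesis using cs(1) by blast
qed

text \<open>The Frattini argument writes g = c n with c in \<open>C B\<close> and n normalizing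
  \<open>K B \<inter> S\<close>. Full invariance takes care of n, and c centralizes
  \<open>B\<close>.\<close>

lemma I_Int_normal:
  assumes B: "B \<lhd> G"
  shows "I (K B \<inter> S) \<inter> B \<lhd> G"
proof (rule normal_invI)
  interpret B: normal B G by fact
  let ?L = "K B \<inter> S"
  show "subgroup (I ?L \<inter> B) G" by (rule subgroups_Inter_pair[OF I_subgroup B.is_subgroup])
  fix g x assume g: "g \<in> carrier G" and x: "x \<in> I ?L \<inter> B"
  have KB: "K B \<lhd> G" by (rule K_props(1)[OF B])
  have Lsub: "subgroup ?L G" by (rule subgroups_Inter_pair[OF normal_imp_subgroup[OF KB] S_subgroup])
  have Lnorm: "?L \<lhd> G\<lparr>carrier := S\<rparr>" using normal_Int_subgroup[OF S_subgroup KB] .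
  obtain c where c: "c \<in> C B" "\<forall>l\<in>?L. (inv c \<otimes> g) \<otimes> l \<otimes> inv (inv c \<otimes> g) \<in> ?L"
    using frattini[OF B g] by blast
  have cc: "c \<in> carrier G" and com: "\<And>b. b \<in> B \<Longrightarrow> c \<otimes> b = b \<otimes> c"
    using c(1) unfolding action_centralizer_conj_action[OF B] by (auto simp: centralizer_def)
  define y where "y = (inv c \<otimes> g) \<otimes> x \<otimes> inv (inv c \<otimes> g)"
  have xc: "x \<in> carrier G" using x by auto
  have "y \<in> I ?L" unfolding y_def
    by (rule I_conj[OF Lsub Lnorm]) (use c g cc x in auto)
  moreover have yB: "y \<in> B" unfolding y_def using B.inv_op_closed2 g cc x by simp
  moreover have "g \<otimes> x \<otimes> inv g = c \<otimes> y \<otimes> inv c"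
    unfolding y_def using g cc xc by (simp add: inv_mult_group m_assoc inv_mult_cancel mult_inv_cancel)
  moreover have "c \<otimes> y \<otimes> inv c = y" using com[OF yB] yB cc by (simp add: m_assoc)
  ultimately show "g \<otimes> x \<otimes> inv g \<in> I ?L \<inter> B" by simp
qed

section \<open>Replacement and the induction on the order of B\<close>

lemma replacement_normal:
  assumes B: "B \<lhd> G" "p_subgroup p G B"
    and cent: "\<And>d b. d \<in> derived G B \<Longrightarrow> b \<in> B \<Longrightarrow> d \<otimes> b = b \<otimes> d"
    and A: "A \<in> \<A>" "derived G B \<subseteq> A" "\<not> B \<subseteq> A"
  shows "\<exists>A\<in>\<A>. \<not> B \<subseteq> A \<and> (\<forall>b\<in>B. \<forall>a\<in>A. b \<otimes> a \<otimes> inv b \<in> A)"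
proof -
  let ?S = "G\<lparr>carrier := S\<rparr>" let ?D = "derived G B"
  interpret B: normal B G by fact
  have BS: "B \<subseteq> S" by (rule normal_p_subgroup_le_S[OF B])
  have BnS: "B \<lhd> ?S" using normal_restrict_supergroup[OF S_subgroup B(1) BS] .
  \<comment> \<open>Replacement is stated for the group on \<open>S\<close>, so commutators and
    normalizers have to be moved between \<open>G\<close> and \<open>S\<close>.\<close>
  have der: "derived ?S B = ?D" using derived_consistent[OF BS S_subgroup] .
  have DB: "?D \<subseteq> B" using derived_incl[OF subset_refl B.is_subgroup] .
  have "h \<otimes>\<^bsub>?S\<^esub> k \<otimes>\<^bsub>?S\<^esub> inv\<^bsub>?S\<^esub> h \<otimes>\<^bsub>?S\<^esub> inv\<^bsub>?S\<^esub> k = \<one>\<^bsub>?S\<^esub>" if "h \<in> ?D" "k \<in> B" for h k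
  proof -
    have "h \<in> S" "k \<in> S" "h \<in> carrier G" "k \<in> carrier G" using that DB BS by auto
    then show ?thesis
      using cent[OF that] m_inv_consistent[OF S_subgroup] by (simp add: m_assoc inv_mult_cancel)
  qed
  then have "comm_subgroup ?S ?D B \<subseteq> {\<one>\<^bsub>?S\<^esub>}"
    unfolding comm_subgroup_def by (intro S.generate_subgroup_incl S.triv_subgroup) blast
  then have "comm_subgroup ?S ?D B = {\<one>\<^bsub>?S\<^esub>}" using generate.one unfolding comm_subgroup_def by blast
  \<comment> \<open>Index 2 of \<open>lower_central\<close>, counted from 0, is [[B, B], B], which
    is trivial because [B, B] is central in \<open>B\<close>.\<close>
  then have "nilpotency_class_le ?S B 2"
    by (simp add: nilpotency_class_le_def numeral_2_eq_2 comm_subgroup_self der)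
  moreover have "\<exists>A\<in>\<A>. derived ?S B \<subseteq> A \<and> \<not> B \<subseteq> A" using A der by auto
  ultimately have "\<exists>A\<in>\<A>. derived ?S B \<subseteq> A \<and> \<not> B \<subseteq> A \<and> B \<subseteq> normalizer ?S A"
    using replacement BnS unfolding replacement_in_def by simp
  then obtain A' where A': "A' \<in> \<A>" "\<not> B \<subseteq> A'" "B \<subseteq> normalizer ?S A'" by auto
  have "b \<otimes> a \<otimes> inv b \<in> A'" if b: "b \<in> B" and a: "a \<in> A'" for b a
  proof -
    have "b <#\<^bsub>?S\<^esub> A' #>\<^bsub>?S\<^esub> inv\<^bsub>?S\<^esub> b = A'"
      using A'(3) b S.mem_normalizer[of A' b] member(2)[OF A'(1)] by auto
    moreover have "inv\<^bsub>?S\<^esub> b = inv b" using m_inv_consistent[OF S_subgroup] b BS by blast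
    ultimately show ?thesis using a by (auto simp: l_coset_def r_coset_def)
  qed
  then show ?thesis using A' by blast
qed

text \<open>Strong induction on \<open>card B\<close> replaces the minimal counterexample. Let W be
  the union of the conjugates of Z \<inter> B. Either W generates a smaller normal subgroup with the
  same intersection with \<open>Z\<close>, and induction applies, or W generates \<open>B\<close>,
  and then \<open>B\<close> turns out to lie in \<open>Z\<close>.\<close>

lemma Z_Int_normal:
  assumes "B \<lhd> G" "p_subgroup p G B"
  shows "Z \<inter> B \<lhd> G"
  using assms
proof (induction "card B" arbitrary: B rule: less_induct)
  case less
  note B = less.prems
  interpret B: normal B G by fact
  have BS: "B \<subseteq> S" by (rule normal_p_subgroup_le_S[OF B])
  have finB: "finite B" using fin B.subset finite_subset by blast
  have ZBsub: "subgroup (Z \<inter> B) G" by (rule subgroups_Inter_pair[OF Z_subgroup B.is_subgroup])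
  have IH: "Z \<inter> N \<lhd> G" if N: "N \<lhd> G" "N \<subseteq> B" "N \<noteq> B" for N
    using less.hyps[OF psubset_card_mono[OF finB] N(1) p_subgroup_subset[OF normal_imp_subgroup[OF N(1)] B(2) N(2)]]
      N(2,3) by blast
  let ?cj = "\<lambda>g. (\<lambda>x. g \<otimes> x \<otimes> inv g) ` (Z \<inter> B)"
  let ?W = "\<Union>g\<in>carrier G. ?cj g"
  have WB: "?W \<subseteq> B" using B.inv_op_closed2 by auto
  have ZW: "Z \<inter> B \<subseteq> ?W" using Z_carrier by (force intro: bexI[of _ \<one>])
  have genn: "generate G ?W \<lhd> G"
  proof (rule normal_generateI)
    show "?W \<subseteq> carrier G" using WB B.subset by blast
    fix h g assume "h \<in> ?W" and g: "g \<in> carrier G"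
    then obtain k x where kx: "k \<in> carrier G" "x \<in> Z \<inter> B" "h = k \<otimes> x \<otimes> inv k" by blast
    then have "g \<otimes> h \<otimes> inv g = (g \<otimes> k) \<otimes> x \<otimes> inv (g \<otimes> k)"
      using g Z_carrier by (simp add: m_assoc inv_mult_group)
    then show "g \<otimes> h \<otimes> inv g \<in> ?W" using kx g by blast
  qed
  have genB: "generate G ?W \<subseteq> B" by (rule generate_subgroup_incl[OF WB B.is_subgroup])
  have Zgen: "Z \<inter> B \<subseteq> generate G ?W" using ZW by (blast intro: generate.incl)
  show ?case
  proof (cases "generate G ?W = B")
    case False
    have "Z \<inter> generate G ?W \<lhd> G" by (rule IH[OF genn genB False])
    moreover have "Z \<inter> generate G ?W = Z \<inter> B" using Zgen genB by blast
    ultimately show ?thesis by simp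
  next
    case gen: True
    \<comment> \<open>A subgroup of \<open>G\<close> contains \<open>B\<close> as soon as it
      contains W; for a normal subgroup it is enough to contain Z \<inter> B.\<close>
    have min: "B \<subseteq> N" if "subgroup N G" "?W \<subseteq> N" for N
      using generate_subgroup_incl[OF that(2,1)] gen by simp
    show ?thesis
    proof (cases "B = {\<one>}")
      case True
      then have "Z \<inter> B = {\<one>}" using subgroup.one_closed[OF Z_subgroup] by blast
      then show ?thesis using one_is_normal by simp
    next
      case nontriv: False
      let ?D = "derived G B" let ?B = "G\<lparr>carrier := B\<rparr>"
      interpret GB: group ?B by (rule subgroup_imp_group[OF B.is_subgroup])
      have Dn: "?D \<lhd> G" by (rule derived_is_normal[OF B(1)])
      have DB: "?D \<subseteq> B" by (rule derived_incl[OF subset_refl B.is_subgroup])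
      \<comment> \<open>The conjugates of Z \<inter> B are abelian normal subgroups of
        \<open>B\<close> and generate it, so \<open>B\<close> is not perfect.\<close>
      have "derived ?B (carrier ?B) \<noteq> carrier ?B"
      proof (rule GB.derived_ne_carrier[where \<N> = "?cj ` carrier G"])
        show "finite (carrier ?B)" "carrier ?B \<noteq> {\<one>\<^bsub>?B\<^esub>}" using finB nontriv by auto
        show "carrier ?B = generate ?B (\<Union>(?cj ` carrier G))"
          using gen generate_consistent[OF WB B.is_subgroup] by simp
      next
        fix N assume "N \<in> ?cj ` carrier G"
        then obtain g where g: "g \<in> carrier G" "N = ?cj g" by blast
        have NB: "N \<subseteq> B" using g WB by blast
        have "subgroup N ?B" using subgroup_incl[OF conj_subgroup[OF g(1) ZBsub] B.is_subgroup] NB g(2) by simp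
        then show "N \<lhd> ?B"
        proof (rule GB.normal_invI)
          fix b x assume "b \<in> carrier ?B" "x \<in> N"
          then obtain z where b: "b \<in> B" and z: "z \<in> Z" "z \<in> B" and x: "x = g \<otimes> z \<otimes> inv g"
            using g(2) by auto
          \<comment> \<open>Conjugating back by g turns b into an element of \<open>B\<close>, hence
            of \<open>S\<close>, and \<open>S\<close> normalizes \<open>Z\<close>.\<close>
          define b' where "b' = inv g \<otimes> b \<otimes> g"
          have b': "b' \<in> B" unfolding b'_def using B.inv_op_closed1[OF g(1) b] .
          have "b' \<otimes> z \<otimes> inv b' \<in> Z \<inter> B"
            using Z_conj_S[of b' z] b' BS z by auto
          moreover have "b \<otimes> x \<otimes> inv b = g \<otimes> (b' \<otimes> z \<otimes> inv b') \<otimes> inv g"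
            unfolding x b'_def using g(1) b z by (simp add: m_assoc inv_mult_group inv_mult_cancel mult_inv_cancel)
          ultimately have "b \<otimes> x \<otimes> inv b \<in> N" using g(2) by blast
          then show "b \<otimes>\<^bsub>?B\<^esub> x \<otimes>\<^bsub>?B\<^esub> inv\<^bsub>?B\<^esub> b \<in> N"
            using m_inv_consistent[OF B.is_subgroup b] by simp
        qed
        fix x y assume "x \<in> N" "y \<in> N"
        then obtain u v where uv: "u \<in> Z" "v \<in> Z" "x = g \<otimes> u \<otimes> inv g" "y = g \<otimes> v \<otimes> inv g"
          using g(2) by auto
        then have "x \<otimes> y = g \<otimes> (u \<otimes> v) \<otimes> inv g" "y \<otimes> x = g \<otimes> (v \<otimes> u) \<otimes> inv g"
          using conj_mult[OF g(1)] Z_carrier by simp_all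
        then show "x \<otimes>\<^bsub>?B\<^esub> y = y \<otimes>\<^bsub>?B\<^esub> x" using Z_comm[OF uv(1,2)] by simp
      qed
      then have DneB: "?D \<noteq> B" using derived_consistent[OF subset_refl B.is_subgroup] by simp
      have ZD: "Z \<inter> ?D \<lhd> G" by (rule IH[OF Dn DB DneB])
      interpret ZD: normal "Z \<inter> ?D" G by fact
      interpret D: normal ?D G by fact
      have D_Z: "?D \<subseteq> Z"
      proof -
        \<comment> \<open>The preimage in \<open>B\<close> of the centre of B / (Z \<inter> [B, B]).
          Once it contains W it is all of \<open>B\<close>, and then [B, B] lies in
          \<open>Z\<close>.\<close>
        let ?N = "{b \<in> B. \<forall>x\<in>B. b \<otimes> x \<otimes> inv b \<otimes> inv x \<in> Z \<inter> ?D}"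
        have "?W \<subseteq> ?N"
        proof
          fix h assume h: "h \<in> ?W"
          then obtain g z where gz: "g \<in> carrier G" "z \<in> Z" "z \<in> B" "h = g \<otimes> z \<otimes> inv g" by auto
          have "h \<otimes> x \<otimes> inv h \<otimes> inv x \<in> Z \<inter> ?D" if x: "x \<in> B" for x
          proof -
            define y where "y = inv g \<otimes> x \<otimes> g"
            have y: "y \<in> B" unfolding y_def using B.inv_op_closed1[OF gz(1) x] .
            \<comment> \<open>y normalizes \<open>Z\<close>, so [z, y] lies in \<open>Z\<close> and
              in [B, B]; by induction Z \<inter> [B, B] is normal in \<open>G\<close>, so
              conjugating by g does not leave it.\<close>
            have "y \<otimes> inv z \<otimes> inv y \<in> Z"
              using Z_conj_S[of y "inv z"] y BS subgroup.m_inv_closed[OF Z_subgroup gz(2)] by blast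
            then have "z \<otimes> (y \<otimes> inv z \<otimes> inv y) \<in> Z" using subgroup.m_closed[OF Z_subgroup gz(2)] by blast
            then have "z \<otimes> y \<otimes> inv z \<otimes> inv y \<in> Z" using y gz by (simp add: m_assoc)
            moreover have "z \<otimes> y \<otimes> inv z \<otimes> inv y \<in> ?D"
              unfolding derived_def using y gz by (blast intro: generate.incl)
            ultimately have "g \<otimes> (z \<otimes> y \<otimes> inv z \<otimes> inv y) \<otimes> inv g \<in> Z \<inter> ?D"
              using ZD.inv_op_closed2[OF gz(1)] by blast
            moreover have "g \<otimes> (z \<otimes> y \<otimes> inv z \<otimes> inv y) \<otimes> inv g = h \<otimes> x \<otimes> inv h \<otimes> inv x"
              unfolding y_def gz(4) using gz(1,3) x
              by (simp add: m_assoc inv_mult_group inv_mult_cancel mult_inv_cancel)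
            ultimately show ?thesis by simp
          qed
          then show "h \<in> ?N" using h WB by blast
        qed
        then have "B \<subseteq> ?N" by (rule min[OF commutators_in_normal_subgroup[OF B.is_subgroup ZD]])
        then have "derived_set G B \<subseteq> Z \<inter> ?D" by blast
        then have "?D \<subseteq> Z \<inter> ?D"
          by (subst derived_def) (rule generate_subgroup_incl[OF _ ZD.is_subgroup])
        then show ?thesis by blast
      qed
      \<comment> \<open>The centralizer of [B, B] is normal in \<open>G\<close> and contains Z
        \<inter> B, since [B, B] lies in the abelian group \<open>Z\<close>. Hence it contains
        \<open>B\<close>.\<close>
      have CD: "centralizer G ?D \<lhd> G" using C_normal[OF Dn] action_centralizer_conj_action[OF Dn] by simp
      have "Z \<inter> B \<subseteq> centralizer G ?D"
        using D_Z Z_comm Z_carrier by (auto simp: centralizer_def)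
      then have "?W \<subseteq> centralizer G ?D" using normal.inv_op_closed2[OF CD] by blast
      then have "B \<subseteq> centralizer G ?D" by (rule min[OF normal_imp_subgroup[OF CD]])
      then have D_cent: "d \<otimes> b = b \<otimes> d" if "d \<in> ?D" "b \<in> B" for d b
        using that by (auto simp: centralizer_def)
      have "B \<subseteq> Z"
      proof (rule ccontr)
        assume "\<not> B \<subseteq> Z"
        \<comment> \<open>A member that does not contain \<open>B\<close> still contains [B, B],
          because \<open>Z\<close> does; this is what replacement asks for.\<close>
        then obtain A0 where A0: "A0 \<in> \<A>" "\<not> B \<subseteq> A0" by blast
        then have "?D \<subseteq> A0" using D_Z by blast
        then obtain A where A: "A \<in> \<A>" "\<not> B \<subseteq> A" "\<forall>b\<in>B. \<forall>a\<in>A. b \<otimes> a \<otimes> inv b \<in> A"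
          using replacement_normal[OF B D_cent A0(1) _ A0(2)] by blast
        have "A \<subseteq> K B"
          by (rule quadratic_subset_K[OF B member(1,3)[OF A(1)]]) (use A in blast)+
        \<comment> \<open>\<open>A\<close> makes the restricted family nonempty. For an empty one
          \<open>I\<close> would be trivial by convention and might fail to contain
          \<open>Z\<close>.\<close>
        then have Ar: "A \<in> family_restrict \<A> (K B \<inter> S)"
          using A(1) member(2) by (auto simp: family_restrict_def)
        then have I_eq: "I (K B \<inter> S) = \<Inter>(family_restrict \<A> (K B \<inter> S))"
          by (auto simp: family_inter_def)
        have "Z \<subseteq> I (K B \<inter> S)" unfolding I_eq by (auto simp: family_restrict_def)
        then have "Z \<inter> B \<subseteq> I (K B \<inter> S) \<inter> B" by blast
        moreover note IB = I_Int_normal[OF B(1)]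
        ultimately have "?W \<subseteq> I (K B \<inter> S) \<inter> B"
          using normal.inv_op_closed2[OF IB] by blast
        then have "B \<subseteq> I (K B \<inter> S)" using min[OF normal_imp_subgroup[OF IB]] by blast
        then show False using Ar A(2) unfolding I_eq by blast
      qed
      then have "Z \<inter> B = B" by blast
      then show ?thesis using B(1) by simp
    qed
  qed
qed

section \<open>From normal to characteristic\<close>

lemma Z_normal: "Z \<lhd> G"
proof -
  have "Z \<inter> p_core p G \<lhd> G" by (rule Z_Int_normal[OF p_core_greatest(1,2)[OF fin p]])
  then show ?thesis using Z_subset_p_core by (simp add: Int_absorb2)
qed

text \<open>An automorphism \<alpha> of \<open>G\<close> maps \<open>S\<close> to a p-subgroup of
  the same order; following it by a conjugation gives an automorphism \<beta> of \<open>S\<close>,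
  which preserves \<open>Z\<close> by full invariance. The conjugation can be undone because
  \<open>Z\<close> is normal.\<close>

lemma Z_characteristic: "characteristic G Z"
  unfolding characteristic_def
proof (intro conjI ballI Z_subgroup)
  fix \<alpha> assume "\<alpha> \<in> auto G"
  then have hom: "\<alpha> \<in> hom G G" and bij: "bij_betw \<alpha> (carrier G) (carrier G)"
    by (auto simp: auto_def Bij_def)
  have inj: "inj_on \<alpha> (carrier G)" using bij by (simp add: bij_betw_def)
  have \<alpha>c: "\<alpha> x \<in> carrier G" if "x \<in> carrier G" for x using hom_in_carrier[OF hom that] .
  have \<alpha>m: "\<alpha> (x \<otimes> y) = \<alpha> x \<otimes> \<alpha> y" if "x \<in> carrier G" "y \<in> carrier G" for x y
    using hom_mult[OF hom that] .
  have Sc: "S \<subseteq> carrier G" using S_carrier by blast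
  have "group_hom G G \<alpha>" using hom by unfold_locales
  then have "subgroup (\<alpha> ` S) G" using group_hom.subgroup_img_is_subgroup[OF _ S_subgroup] by blast
  moreover have "card (\<alpha> ` S) = card S" using card_image[OF inj_on_subset[OF inj Sc]] .
  ultimately have "p_subgroup p G (\<alpha> ` S)" using S_p_subgroup by (auto simp: p_subgroup_def)
  then obtain h where h: "h \<in> carrier G" "\<forall>q\<in>\<alpha> ` S. inv h \<otimes> q \<otimes> h \<in> S" using conj_into_S by blast
  define \<beta> where "\<beta> = (\<lambda>x. inv h \<otimes> \<alpha> x \<otimes> h)"
  have "inj_on \<beta> S"
  proof (rule inj_onI)
    fix x y assume xy: "x \<in> S" "y \<in> S" "\<beta> x = \<beta> y"
    then have "\<alpha> x = \<alpha> y" using h(1) \<alpha>c S_carrier by (simp add: \<beta>_def)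
    then show "x = y" using inj_onD[OF inj] xy S_carrier by blast
  qed
  moreover have \<beta>S: "\<beta> ` S \<subseteq> S" using h(2) by (auto simp: \<beta>_def)
  ultimately have "bij_betw \<beta> S S"
    using endo_inj_surj[of S \<beta>] finite_subset[OF Sc fin] by (simp add: bij_betw_def)
  moreover have "\<beta> (x \<otimes> y) = \<beta> x \<otimes> \<beta> y" if "x \<in> S" "y \<in> S" for x y
    using that h(1) \<alpha>c \<alpha>m S_carrier by (simp add: \<beta>_def m_assoc mult_inv_cancel)
  ultimately have \<beta>Z: "\<beta> ` Z = Z" using I_image[OF S_subgroup S_normal_S] Z_eq by simp
  have "\<alpha> x \<in> Z" if x: "x \<in> Z" for x
  proof -
    have "\<beta> x \<in> Z" using \<beta>Z x by blast
    then have "h \<otimes> \<beta> x \<otimes> inv h \<in> Z" using normal.inv_op_closed2[OF Z_normal h(1)] by blast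
    moreover have "h \<otimes> \<beta> x \<otimes> inv h = \<alpha> x"
      using h(1) \<alpha>c[OF Z_carrier[OF x]] by (simp add: \<beta>_def m_assoc mult_inv_cancel)
    ultimately show ?thesis by simp
  qed
  moreover have Zc: "Z \<subseteq> carrier G" using Z_carrier by blast
  ultimately show "\<alpha> ` Z = Z"
    using endo_inj_surj[OF finite_subset[OF Zc fin] _ inj_on_subset[OF inj Zc]] by blast
qed

end

section \<open>Transport along isomorphisms\<close>

lemma (in group_hom) comm_subgroup_img:
  assumes "K \<subseteq> carrier G" "L \<subseteq> carrier G"
  shows "comm_subgroup H (h ` K) (h ` L) = h ` comm_subgroup G K L"
proof -
  let ?X = "\<Union>x\<in>K. \<Union>y\<in>L. {x \<otimes> y \<otimes> inv x \<otimes> inv y}"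
  have X: "?X \<subseteq> carrier G" using assms by (auto simp: subset_iff)
  have "h (x \<otimes> y \<otimes> inv x \<otimes> inv y) = h x \<otimes>\<^bsub>H\<^esub> h y \<otimes>\<^bsub>H\<^esub> inv\<^bsub>H\<^esub> h x \<otimes>\<^bsub>H\<^esub> inv\<^bsub>H\<^esub> h y"
    if "x \<in> K" "y \<in> L" for x y
    using that assms by (simp add: subset_iff)
  then have "h ` ?X = (\<Union>x\<in>h ` K. \<Union>y\<in>h ` L. {x \<otimes>\<^bsub>H\<^esub> y \<otimes>\<^bsub>H\<^esub> inv\<^bsub>H\<^esub> x \<otimes>\<^bsub>H\<^esub> inv\<^bsub>H\<^esub> y})"
    by (simp add: image_UN)
  then show ?thesis using generate_img[OF X] by (simp add: comm_subgroup_def)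
qed

lemma (in group) comm_subgroup_carrier:
  assumes "K \<subseteq> carrier G" "L \<subseteq> carrier G"
  shows "comm_subgroup G K L \<subseteq> carrier G"
  unfolding comm_subgroup_def using assms by (intro generate_incl) (auto simp: subset_iff)

lemma (in group) lower_central_carrier: "K \<subseteq> carrier G \<Longrightarrow> lower_central G K n \<subseteq> carrier G"
  by (induction n) (simp_all add: comm_subgroup_carrier)

lemma (in group_hom) lower_central_img:
  "K \<subseteq> carrier G \<Longrightarrow> lower_central H (h ` K) n = h ` lower_central G K n"
  by (induction n) (simp_all add: comm_subgroup_img G.lower_central_carrier)

lemma conj_coset_eq:
  "g <#\<^bsub>G\<^esub> H #>\<^bsub>G\<^esub> k = (\<lambda>h. g \<otimes>\<^bsub>G\<^esub> h \<otimes>\<^bsub>G\<^esub> k) ` H"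
  by (auto simp: l_coset_def r_coset_def)

text \<open>Injectivity makes images commute with intersections. The condition on the unit serves
  the empty family.\<close>

lemma family_inter_img:
  assumes "inj_on \<iota> (carrier S)" "\<And>A. A \<in> \<A> \<Longrightarrow> A \<subseteq> carrier S" "\<iota> \<one>\<^bsub>S\<^esub> = \<one>\<^bsub>H\<^esub>"
  shows "family_inter H ((`) \<iota> ` \<A>) = \<iota> ` family_inter S \<A>"
proof (cases "\<A> = {}")
  case False
  then obtain A where "A \<in> \<A>" by blast
  then have "\<iota> ` (\<Inter>((\<lambda>A. A) ` \<A>)) = (\<Inter>A\<in>\<A>. \<iota> ` A)"
    using assms(1,2) by (intro image_INT[where C = "carrier S"]) auto
  then show ?thesis using False by (simp add: family_inter_def)
qed (simp add: family_inter_def assms(3))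

text \<open>The hypotheses on the family are given for the abstract group \<open>S\<close>; this
  setting moves them to its image in \<open>G\<close>.\<close>

locale group_isomorphism = group_hom S H \<iota> for S (structure) and H (structure) and \<iota> +
  assumes inj: "inj_on \<iota> (carrier S)" and surj: "\<iota> ` carrier S = carrier H"
begin

lemma image_subset_image_iff:
  assumes "K \<subseteq> carrier S" "L \<subseteq> carrier S"
  shows "\<iota> ` K \<subseteq> \<iota> ` L \<longleftrightarrow> K \<subseteq> L"
  using inj_on_image_mem_iff[OF inj _ assms(2)] assms(1) by blast

text \<open>Every normal subgroup of \<open>H\<close> is the image of one of \<open>S\<close>, so a
  condition on all normal subgroups of \<open>H\<close> can be checked in \<open>S\<close>.\<close>

lemma preimage_normal:
  assumes "N \<lhd> H"
  shows "{x \<in> carrier S. \<iota> x \<in> N} \<lhd> S" "\<iota> ` {x \<in> carrier S. \<iota> x \<in> N} = N"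
proof -
  interpret N: normal N H by fact
  show "{x \<in> carrier S. \<iota> x \<in> N} \<lhd> S"
    by (rule G.normal_invI) (auto intro!: G.subgroupI N.inv_op_closed2 exI[of _ "\<one>\<^bsub>S\<^esub>"])
  show "\<iota> ` {x \<in> carrier S. \<iota> x \<in> N} = N" using surj N.subset by (auto simp: image_iff subset_iff)
qed

lemma image_abelian:
  assumes "is_abelian_subgroup S A"
  shows "is_abelian_subgroup H (\<iota> ` A)"
proof -
  have A: "subgroup A S" and comm: "comm_group (S\<lparr>carrier := A\<rparr>)"
    using assms by (auto simp: is_abelian_subgroup_def)
  have iA: "subgroup (\<iota> ` A) H" by (rule subgroup_img_is_subgroup[OF A])
  have Ac: "x \<in> carrier S" if "x \<in> A" for x using subgroup.mem_carrier[OF A that] .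
  have "x \<otimes>\<^bsub>S\<^esub> y = y \<otimes>\<^bsub>S\<^esub> x" if "x \<in> A" "y \<in> A" for x y
    using comm_monoid.m_comm[OF comm_group.axioms(1)[OF comm], of x y] that by simp
  then have "\<iota> x \<otimes>\<^bsub>H\<^esub> \<iota> y = \<iota> y \<otimes>\<^bsub>H\<^esub> \<iota> x" if "x \<in> A" "y \<in> A" for x y
    using that Ac by (metis hom_mult)
  then have "comm_group (H\<lparr>carrier := \<iota> ` A\<rparr>)"
    by (intro group.group_comm_groupI[OF H.subgroup_imp_group[OF iA]]) auto
  then show ?thesis using iA by (simp add: is_abelian_subgroup_def)
qed

text \<open>\<open>B\<close> is pulled back to \<open>S\<close>, replacement there yields a member,
  and its image is the required one.\<close>

lemma image_replacement:
  assumes sub: "\<And>A. A \<in> \<A> \<Longrightarrow> A \<subseteq> carrier S" and rep: "replacement_in S \<A>"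
  shows "replacement_in H ((`) \<iota> ` \<A>)"
  unfolding replacement_in_def
proof (intro allI impI, elim conjE)
  fix B assume B: "B \<lhd> H" and nil: "nilpotency_class_le H B 2"
    and ex: "\<exists>A\<in>(`) \<iota> ` \<A>. derived H B \<subseteq> A \<and> \<not> B \<subseteq> A"
  define B' where "B' = {x \<in> carrier S. \<iota> x \<in> B}"
  have B': "B' \<lhd> S" "\<iota> ` B' = B" unfolding B'_def by (rule preimage_normal[OF B])+
  have B'c: "B' \<subseteq> carrier S" by (auto simp: B'_def)
  have der: "derived H B = \<iota> ` derived S B'" using derived_img[OF B'c] B'(2) by simp
  have derc: "derived S B' \<subseteq> carrier S" by (rule G.derived_in_carrier[OF B'c])
  have lc: "lower_central S B' 2 \<subseteq> carrier S" by (rule G.lower_central_carrier[OF B'c])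
  have "\<iota> ` lower_central S B' 2 = \<iota> ` {\<one>\<^bsub>S\<^esub>}"
    using lower_central_img[OF B'c, of 2] nil B'(2) by (simp add: nilpotency_class_le_def)
  then have "lower_central S B' 2 = {\<one>\<^bsub>S\<^esub>}"
    by (rule inj_on_image_eq_iff[OF inj lc, THEN iffD1, rotated]) simp
  then have nil': "nilpotency_class_le S B' 2" by (simp add: nilpotency_class_le_def)
  obtain A where A: "A \<in> \<A>" "derived H B \<subseteq> \<iota> ` A" "\<not> B \<subseteq> \<iota> ` A" using ex by blast
  have "derived S B' \<subseteq> A"
    using A(2) image_subset_image_iff[OF derc sub[OF A(1)]] unfolding der by simp
  moreover have "\<not> B' \<subseteq> A" using A(3) B'(2) by blast
  ultimately have "\<exists>A\<in>\<A>. derived S B' \<subseteq> A \<and> \<not> B' \<subseteq> A \<and> B' \<subseteq> normalizer S A"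
    using rep B'(1) nil' A(1) unfolding replacement_in_def by auto
  then obtain A1 where A1: "A1 \<in> \<A>" "derived S B' \<subseteq> A1" "\<not> B' \<subseteq> A1" "B' \<subseteq> normalizer S A1"
    by auto
  have A1c: "A1 \<subseteq> carrier S" by (rule sub[OF A1(1)])
  have "b \<in> normalizer H (\<iota> ` A1)" if b: "b \<in> B" for b
  proof -
    obtain x where x: "x \<in> B'" "b = \<iota> x" using b B'(2) by blast
    have xc: "x \<in> carrier S" using x B'c by blast
    have "x <#\<^bsub>S\<^esub> A1 #>\<^bsub>S\<^esub> inv\<^bsub>S\<^esub> x = A1" using x A1(4) G.mem_normalizer[OF A1c] by blast
    moreover have "\<iota> ` (x <#\<^bsub>S\<^esub> A1 #>\<^bsub>S\<^esub> inv\<^bsub>S\<^esub> x) = b <#\<^bsub>H\<^esub> \<iota> ` A1 #>\<^bsub>H\<^esub> inv\<^bsub>H\<^esub> b"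
    proof -
      have "\<iota> (x \<otimes>\<^bsub>S\<^esub> a \<otimes>\<^bsub>S\<^esub> inv\<^bsub>S\<^esub> x) = b \<otimes>\<^bsub>H\<^esub> \<iota> a \<otimes>\<^bsub>H\<^esub> inv\<^bsub>H\<^esub> b" if "a \<in> A1" for a
        using that A1c xc x(2) by (simp add: subset_iff)
      then show ?thesis unfolding conj_coset_eq image_image by (intro image_cong) auto
    qed
    moreover have "\<iota> ` A1 \<subseteq> carrier H" using A1c by auto
    ultimately show ?thesis using H.mem_normalizer x xc by auto
  qed
  then have "B \<subseteq> normalizer H (\<iota> ` A1)" by blast
  moreover have "derived H B \<subseteq> \<iota> ` A1" unfolding der using A1(2) by blast
  moreover have "\<not> B \<subseteq> \<iota> ` A1"
    using A1(3) image_subset_image_iff[OF B'c A1c] B'(2) by simp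
  ultimately show "\<exists>A\<in>(`) \<iota> ` \<A>. derived H B \<subseteq> A \<and> \<not> B \<subseteq> A \<and> B \<subseteq> normalizer H A"
    using A1(1) by blast
qed

text \<open>An automorphism \<alpha> of \<open>P\<close> becomes the automorphism \<iota>^-1
  \<alpha> \<iota> of the preimage of \<open>P\<close>, which preserves the intersection
  there.\<close>

lemma image_fully_invariant:
  assumes sub: "\<And>A. A \<in> \<A> \<Longrightarrow> A \<subseteq> carrier S" and inv: "fully_invariant_in S \<A>"
  shows "fully_invariant_in H ((`) \<iota> ` \<A>)"
  unfolding fully_invariant_in_def
proof (intro allI impI ballI)
  fix P \<alpha> assume P: "P \<lhd> H" and \<alpha>: "\<alpha> \<in> auto (H\<lparr>carrier := P\<rparr>)"
  define P' where "P' = {x \<in> carrier S. \<iota> x \<in> P}"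
  have P': "P' \<lhd> S" "\<iota> ` P' = P" unfolding P'_def by (rule preimage_normal[OF P])+
  have P'c: "P' \<subseteq> carrier S" by (auto simp: P'_def)
  have bij\<iota>: "bij_betw \<iota> P' P" using P'(2) inj_on_subset[OF inj P'c] by (simp add: bij_betw_def)
  let ?F = "family_restrict \<A> P'"
  have "A \<subseteq> P' \<longleftrightarrow> \<iota> ` A \<subseteq> P" if "A \<in> \<A>" for A using sub[OF that] by (auto simp: P'_def)
  then have "family_restrict ((`) \<iota> ` \<A>) P = (`) \<iota> ` ?F" by (auto simp: family_restrict_def)
  moreover have "family_inter H ((`) \<iota> ` ?F) = \<iota> ` family_inter S ?F"
    by (rule family_inter_img[OF inj]) (auto simp: family_restrict_def dest: sub)
  ultimately have eq: "family_inter H (family_restrict ((`) \<iota> ` \<A>) P) = \<iota> ` family_inter S ?F" by simp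
  have IP: "family_inter S ?F \<subseteq> P'"
  proof (cases "?F = {}")
    case True
    then show ?thesis using subgroup.one_closed[OF normal_imp_subgroup[OF P'(1)]] by (simp add: family_inter_def)
  next
    case False
    then obtain A where "A \<in> ?F" by blast
    then have "\<Inter>?F \<subseteq> P'" by (auto simp: family_restrict_def)
    then show ?thesis using False by (simp add: family_inter_def)
  qed
  have \<alpha>m: "\<alpha> (x \<otimes>\<^bsub>H\<^esub> y) = \<alpha> x \<otimes>\<^bsub>H\<^esub> \<alpha> y" if "x \<in> P" "y \<in> P" for x y
    using \<alpha> that by (auto simp: auto_def hom_def)
  have bij\<alpha>: "bij_betw \<alpha> P P" using \<alpha> by (auto simp: auto_def Bij_def)
  define \<beta> where "\<beta> = (\<lambda>x\<in>P'. the_inv_into P' \<iota> (\<alpha> (\<iota> x)))"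
  have "bij_betw (the_inv_into P' \<iota> \<circ> (\<alpha> \<circ> \<iota>)) P' P'"
    by (rule bij_betw_trans[OF bij_betw_trans[OF bij\<iota> bij\<alpha>] bij_betw_the_inv_into[OF bij\<iota>]])
  then have bij\<beta>: "bij_betw \<beta> P' P'" by (simp add: \<beta>_def comp_def cong: bij_betw_cong)
  have \<iota>\<beta>: "\<iota> (\<beta> x) = \<alpha> (\<iota> x)" if x: "x \<in> P'" for x
  proof -
    have "\<alpha> (\<iota> x) \<in> \<iota> ` P'" using x bij_betw_apply[OF bij\<alpha>] P'(2) by blast
    then show ?thesis using x f_the_inv_into_f[of \<iota> P'] bij\<iota> by (simp add: \<beta>_def bij_betw_def)
  qed
  have cl: "x \<otimes>\<^bsub>S\<^esub> y \<in> P'" if "x \<in> P'" "y \<in> P'" for x y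
    using subgroup.m_closed[OF normal_imp_subgroup[OF P'(1)] that] .
  have "\<beta> (x \<otimes>\<^bsub>S\<^esub> y) = \<beta> x \<otimes>\<^bsub>S\<^esub> \<beta> y" if xy: "x \<in> P'" "y \<in> P'" for x y
  proof -
    have c: "x \<in> carrier S" "y \<in> carrier S" "\<beta> x \<in> P'" "\<beta> y \<in> P'" "\<iota> x \<in> P" "\<iota> y \<in> P"
      using xy P'c bij_betw_apply[OF bij\<beta>] P'(2) by auto
    have "\<iota> (\<beta> (x \<otimes>\<^bsub>S\<^esub> y)) = \<iota> (\<beta> x \<otimes>\<^bsub>S\<^esub> \<beta> y)"
      using c xy cl P'c by (simp add: \<iota>\<beta> \<alpha>m subset_iff)
    then show ?thesis
      using inj_onD[OF inj_on_subset[OF inj P'c]] bij_betw_apply[OF bij\<beta>] cl c xy by blast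
  qed
  then have "\<beta> \<in> auto (S\<lparr>carrier := P'\<rparr>)"
    using bij\<beta> bij_betw_apply[OF bij\<beta>] by (auto simp: auto_def Bij_def \<beta>_def intro!: homI)
  then have \<beta>I: "\<beta> ` family_inter S ?F = family_inter S ?F"
    using inv P'(1) by (simp add: fully_invariant_in_def)
  have "\<alpha> ` \<iota> ` family_inter S ?F = \<iota> ` \<beta> ` family_inter S ?F"
    unfolding image_image using \<iota>\<beta> IP by (intro image_cong) auto
  then show "\<alpha> ` family_inter H (family_restrict ((`) \<iota> ` \<A>) P)
      = family_inter H (family_restrict ((`) \<iota> ` \<A>) P)"
    unfolding eq \<beta>I .
qed

end

section \<open>The Glauberman property of the intersection\<close>

lemma (in group) characteristic_one: "characteristic G {\<one>}"
proof -
  have "\<alpha> \<one> = \<one>" if "\<alpha> \<in> auto G" for \<alpha>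
    using that hom_one[OF _ group_axioms group_axioms] by (auto simp: auto_def)
  then show ?thesis by (simp add: characteristic_def triv_subgroup)
qed

theorem corollary1p2:
  fixes S :: "'a monoid" and p :: nat and \<A> :: "'a set set"
  assumes "Factorial_Ring.prime p"
    and "group S" and "finite (carrier S)" and "\<exists>n. order S = p ^ n"
    and "\<And>A. A \<in> \<A> \<Longrightarrow> is_abelian_subgroup S A"
    and "replacement_in S \<A>"
    and "fully_invariant_in S \<A>"
  shows "glauberman_property TYPE('b) p S (family_inter S \<A>)"
  unfolding glauberman_property_def
proof (intro conjI allI impI, goal_cases)
  have sub: "subgroup A S" if "A \<in> \<A>" for A using assms(5)[OF that] by (simp add: is_abelian_subgroup_def)
  have subc: "A \<subseteq> carrier S" if "A \<in> \<A>" for A using subgroup.subset[OF sub[OF that]] .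
  {
    case 1
    show ?case
    proof (cases "\<A> = {}")
      case True
      then show ?thesis using group.triv_subgroup[OF assms(2)] by (simp add: family_inter_def)
    next
      case False
      then show ?thesis using group.subgroups_Inter[OF assms(2)] sub by (simp add: family_inter_def)
    qed
  next
    case (2 G \<iota>)
    then have G: "group G" "finite (carrier G)" and hom: "\<iota> \<in> hom S G" and inj: "inj_on \<iota> (carrier S)"
      and syl: "sylow_subgroup p G (\<iota> ` carrier S)"
      and core: "centralizer G (p_core p G) \<subseteq> p_core p G"
      and stable: "\<And>P. P \<lhd> G \<Longrightarrow> p_subgroup p G P \<Longrightarrow>
        p_stable_action p G (G\<lparr>carrier := P\<rparr>) (conj_action G P)" by blast+
    interpret G: group G by (rule G(1))
    interpret \<iota>: group_hom S G \<iota>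
      using assms(2) G(1) hom by (simp add: group_hom_def group_hom_axioms_def)
    let ?T = "\<iota> ` carrier S" let ?H = "G\<lparr>carrier := \<iota> ` carrier S\<rparr>"
    have T: "subgroup ?T G" using syl by (simp add: sylow_subgroup_def)
    have "\<iota> \<in> hom S ?H" using hom by (auto simp: hom_def)
    then interpret iso: group_isomorphism S ?H \<iota>
      using assms(2) G.subgroup_imp_group[OF T] inj
      by (simp add: group_isomorphism_def group_isomorphism_axioms_def group_hom_def group_hom_axioms_def)
    show ?case
    proof (cases "\<A> = {}")
      \<comment> \<open>By convention the empty family gives the trivial subgroup; the locale
        assumes a nonempty family.\<close>
      case True
      then show ?thesis using G.characteristic_one by (simp add: family_inter_def)
    next
      case False
      \<comment> \<open>Inside \<open>G\<close> the image of \<open>S\<close> takes the place of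
        \<open>S\<close>, and the images of the members form the family.\<close>
      interpret glauberman_family G p ?T "(`) \<iota> ` \<A>"
      proof unfold_locales
        show "is_abelian_subgroup ?H A" if "A \<in> (`) \<iota> ` \<A>" for A
          using that iso.image_abelian assms(5) by blast
        show "replacement_in ?H ((`) \<iota> ` \<A>)" by (rule iso.image_replacement[OF subc assms(6)])
        show "fully_invariant_in ?H ((`) \<iota> ` \<A>)" by (rule iso.image_fully_invariant[OF subc assms(7)])
      qed (use G(2) assms(1) syl core stable False in blast)+
      have "\<iota> ` family_inter S \<A> = \<Inter>((`) \<iota> ` \<A>)"
        using family_inter_img[OF inj subc, of \<A> G] False by (simp add: family_inter_def)
      then show ?thesis using Z_characteristic by simp
    qed
  }
qed

end
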